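(* Let $V=\mathbb R^n$ and let $r,s$ be integers with $1\le r,s\le n/2$. Suppose that $U\subseteq\bigwedge^r V$ and $W\subseteq\bigwedge^s V$ are linear subspaces such that $u\wedge w=0$ whenever $u\in U$ and $w\in W$. Then $$(\dim U)(\dim W)\le\binom{n-1}{r-1}\binom{n-1}{s-1}.$$
   Context: $\bigwedge^r V$ denotes the $r$-th exterior power of $V$, the degree-$r$ part of the exterior algebra $\bigwedge V$. *)

theory Defs
  imports "HOL-Analysis.Analysis" "HOL-Library.Poly_Mapping"
begin

text \<open>
  The exterior algebra of a real vector space \<open>V\<close> is the quotient of the tensor algebra of \<open>V\<close> by
  the two-sided ideal generated by all \<open>v \<otimes> v\<close>.  The tensor algebra is itself the quotient of the
  free associative algebra on the underlying set of \<open>V\<close> by the relations that make the generators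
  depend linearly on \<open>v\<close>.  Both quotients are taken here in one step.  No basis is chosen.
\<close>

subsection \<open>The free associative algebra on a type\<close>

datatype 'v monomial = Monomial (factors: "'v list")

instantiation monomial :: (type) monoid_add
begin

definition zero_monomial :: "'a monomial"
  where "0 = Monomial []"

definition plus_monomial :: "'a monomial \<Rightarrow> 'a monomial \<Rightarrow> 'a monomial"
  where "a + b = Monomial (factors a @ factors b)"

instance
  by standard (auto simp: zero_monomial_def plus_monomial_def)

end

lemma monomial_add_eq_0_iff: "a + b = 0 \<longleftrightarrow> a = 0 \<and> b = (0 :: 'v monomial)"
  by (cases a; cases b) (auto simp: zero_monomial_def plus_monomial_def)

lemma Monomial_Cons_neq_0: "Monomial (v # vs) \<noteq> 0"
  by (simp add: zero_monomial_def)

text \<open>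
  \<open>'v free_algebra\<close> has the words over \<open>'v\<close> as its basis, and its product (the one of
  \<^theory>\<open>HOL-Library.Poly_Mapping\<close>) concatenates words.  \<open>Poly_Mapping.single 0 c\<close> is the scalar \<open>c\<close>.
\<close>

type_synonym 'v free_algebra = "'v monomial \<Rightarrow>\<^sub>0 real"

definition gen :: "'v \<Rightarrow> 'v free_algebra"
  where "gen v = Poly_Mapping.single (Monomial [v]) 1"

lemma lookup_mult_0:
  fixes x y :: "'v free_algebra"
  shows "Poly_Mapping.lookup (x * y) 0 = Poly_Mapping.lookup x 0 * Poly_Mapping.lookup y 0"
proof -
  have "Sum_any (\<lambda>q. Poly_Mapping.lookup y q when 0 = l + q) = (Poly_Mapping.lookup y 0 when l = 0)" for l :: "'v monomial"
  proof -
    have "(\<lambda>q. Poly_Mapping.lookup y q when 0 = l + q) = (\<lambda>q. (Poly_Mapping.lookup y 0 when l = 0) when q = 0)"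
      using monomial_add_eq_0_iff[of l] by (auto simp: fun_eq_iff when_def)
    then show ?thesis by (simp only: Sum_any_when_equal)
  qed
  then have "Poly_Mapping.lookup (x * y) 0 = Sum_any (\<lambda>l. (Poly_Mapping.lookup x l * Poly_Mapping.lookup y 0) when l = 0)"
    by (simp add: lookup_mult mult_when)
  also have "(\<lambda>l. (Poly_Mapping.lookup x l * Poly_Mapping.lookup y 0) when l = 0)
      = (\<lambda>l. (Poly_Mapping.lookup x 0 * Poly_Mapping.lookup y 0) when l = 0)"
    by (auto simp: fun_eq_iff when_def)
  finally show ?thesis by simp
qed

lemma scalar_central:
  fixes x :: "'v free_algebra"
  shows "Poly_Mapping.single 0 c * x = x * Poly_Mapping.single 0 c"
proof (induction x rule: update_induct)
  case const
  show ?case by simp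
next
  case (update f a b)
  have "Poly_Mapping.update a b f = f + Poly_Mapping.single a b"
    using update by (intro poly_mapping_eqI)
      (auto simp: lookup_update lookup_add lookup_single when_def in_keys_iff)
  then show ?case
    using update by (simp add: algebra_simps mult_single)
qed

lemma scalar_left_commute:
  fixes x y :: "'v free_algebra"
  shows "x * (Poly_Mapping.single 0 c * y) = Poly_Mapping.single 0 c * (x * y)"
  by (metis mult.assoc scalar_central)

subsection \<open>The exterior algebra\<close>

inductive_set exterior_ideal :: "'v::real_vector free_algebra set" where
  zero: "0 \<in> exterior_ideal"
| add: "x \<in> exterior_ideal \<Longrightarrow> y \<in> exterior_ideal \<Longrightarrow> x + y \<in> exterior_ideal"
| mult_left: "x \<in> exterior_ideal \<Longrightarrow> a * x \<in> exterior_ideal"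
| mult_right: "x \<in> exterior_ideal \<Longrightarrow> x * a \<in> exterior_ideal"
| gen_add: "gen (v + w) - gen v - gen w \<in> exterior_ideal"
| gen_scaleR: "gen (c *\<^sub>R v) - Poly_Mapping.single 0 c * gen v \<in> exterior_ideal"
| gen_square: "gen v * gen v \<in> exterior_ideal"

lemma exterior_ideal_uminus: "x \<in> exterior_ideal \<Longrightarrow> - x \<in> exterior_ideal"
  using exterior_ideal.mult_left[of x "- 1"] by simp

lemma exterior_ideal_augmentation: "x \<in> exterior_ideal \<Longrightarrow> Poly_Mapping.lookup x 0 = 0"
  by (induction rule: exterior_ideal.induct)
    (simp_all add: lookup_add lookup_minus lookup_mult_0 gen_def lookup_single Monomial_Cons_neq_0)

definition exterior_rel :: "'v::real_vector free_algebra \<Rightarrow> 'v free_algebra \<Rightarrow> bool"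
  where "exterior_rel x y \<longleftrightarrow> x - y \<in> exterior_ideal"

lemma exterior_rel_refl: "exterior_rel x x"
  by (simp add: exterior_rel_def exterior_ideal.zero)

quotient_type (overloaded) 'v exterior = "'v::real_vector free_algebra" / exterior_rel
proof (rule equivpI)
  show "reflp (exterior_rel :: 'v free_algebra \<Rightarrow> _)"
    by (simp add: reflpI exterior_rel_refl)
  show "symp (exterior_rel :: 'v free_algebra \<Rightarrow> _)"
    by (rule sympI) (metis exterior_rel_def exterior_ideal_uminus minus_diff_eq)
  show "transp (exterior_rel :: 'v free_algebra \<Rightarrow> _)"
  proof (rule transpI)
    fix x y z :: "'v free_algebra"
    assume "exterior_rel x y" "exterior_rel y z"
    then show "exterior_rel x z"
      using exterior_ideal.add[of "x - y" "y - z"] by (simp add: exterior_rel_def)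
  qed
qed

instantiation exterior :: (real_vector) real_algebra_1
begin

lift_definition zero_exterior :: "'a exterior" is 0 .

lift_definition one_exterior :: "'a exterior" is 1 .

lift_definition plus_exterior :: "'a exterior \<Rightarrow> 'a exterior \<Rightarrow> 'a exterior" is "(+)"
proof -
  fix x x' y y' :: "'a free_algebra"
  assume "exterior_rel x x'" "exterior_rel y y'"
  then show "exterior_rel (x + y) (x' + y')"
    using exterior_ideal.add[of "x - x'" "y - y'"]
    by (simp add: exterior_rel_def algebra_simps)
qed

lift_definition uminus_exterior :: "'a exterior \<Rightarrow> 'a exterior" is uminus
proof -
  fix x x' :: "'a free_algebra"
  assume "exterior_rel x x'"
  then show "exterior_rel (- x) (- x')"
    using exterior_ideal_uminus[of "x - x'"] by (simp add: exterior_rel_def)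
qed

lift_definition minus_exterior :: "'a exterior \<Rightarrow> 'a exterior \<Rightarrow> 'a exterior" is "(-)"
proof -
  fix x x' y y' :: "'a free_algebra"
  assume "exterior_rel x x'" "exterior_rel y y'"
  then show "exterior_rel (x - y) (x' - y')"
    using exterior_ideal.add[OF _ exterior_ideal_uminus, of "x - x'" "y - y'"]
    by (simp add: exterior_rel_def algebra_simps)
qed

lift_definition times_exterior :: "'a exterior \<Rightarrow> 'a exterior \<Rightarrow> 'a exterior" is "(*)"
proof -
  fix x x' y y' :: "'a free_algebra"
  assume "exterior_rel x x'" "exterior_rel y y'"
  then have "(x - x') * y + x' * (y - y') \<in> exterior_ideal"
    by (intro exterior_ideal.add exterior_ideal.mult_left exterior_ideal.mult_right)
      (simp_all add: exterior_rel_def)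
  then show "exterior_rel (x * y) (x' * y')"
    by (simp add: exterior_rel_def algebra_simps)
qed

lift_definition scaleR_exterior :: "real \<Rightarrow> 'a exterior \<Rightarrow> 'a exterior"
  is "\<lambda>c x. Poly_Mapping.single 0 c * x"
proof -
  fix c and x x' :: "'a free_algebra"
  assume "exterior_rel x x'"
  then show "exterior_rel (Poly_Mapping.single 0 c * x) (Poly_Mapping.single 0 c * x')"
    using exterior_ideal.mult_left[of "x - x'" "Poly_Mapping.single 0 c"]
    by (simp add: exterior_rel_def right_diff_distrib)
qed

instance
proof
  fix a b c :: "'a exterior" and r s :: real
  show "a + b + c = a + (b + c)" "a + b = b + a" "0 + a = a" "- a + a = 0" "a - b = a + - b"
    by (transfer, simp add: exterior_rel_refl algebra_simps)+
  show "a * b * c = a * (b * c)" "1 * a = a" "a * 1 = a"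
    by (transfer, simp add: exterior_rel_refl mult.assoc)+
  show "(a + b) * c = a * c + b * c" "a * (b + c) = a * b + a * c"
    by (transfer, simp add: exterior_rel_refl algebra_simps)+
  show "r *\<^sub>R (a + b) = r *\<^sub>R a + r *\<^sub>R b" "(r + s) *\<^sub>R a = r *\<^sub>R a + s *\<^sub>R a"
    by (transfer, simp add: exterior_rel_refl single_add algebra_simps)+
  show "r *\<^sub>R s *\<^sub>R a = (r * s) *\<^sub>R a"
    by (transfer, simp add: exterior_rel_refl mult_single mult.assoc[symmetric])
  show "1 *\<^sub>R a = a"
    by (transfer, simp add: exterior_rel_refl)
  show "r *\<^sub>R a * b = r *\<^sub>R (a * b)"
    by (transfer, simp add: exterior_rel_refl mult.assoc)
  show "a * r *\<^sub>R b = r *\<^sub>R (a * b)"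
    by (transfer, simp add: exterior_rel_refl scalar_left_commute)
  show "(0 :: 'a exterior) \<noteq> 1"
    by transfer (auto simp: exterior_rel_def lookup_minus dest: exterior_ideal_augmentation)
qed

end

abbreviation wedge :: "'v::real_vector exterior \<Rightarrow> 'v exterior \<Rightarrow> 'v exterior"  (infixl "\<^bold>\<and>" 70)
  where "u \<^bold>\<and> w \<equiv> u * w"

lift_definition ext_vec :: "'v::real_vector \<Rightarrow> 'v exterior" is gen .

lemma linear_ext_vec: "linear ext_vec"
  by (rule linearI; transfer)
    (use exterior_ideal.gen_add exterior_ideal.gen_scaleR in \<open>simp_all add: exterior_rel_def diff_diff_eq\<close>)

lemma ext_vec_square: "ext_vec v * ext_vec v = 0"
  by transfer (simp add: exterior_rel_def exterior_ideal.gen_square)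

text \<open>The \<open>r\<close>-th exterior power, as the degree-\<open>r\<close> part of the exterior algebra.\<close>

definition ext_power :: "nat \<Rightarrow> 'v::real_vector exterior set"
  where "ext_power r = span {prod_list (map ext_vec vs) | vs. length vs = r}"

end

theory Submission
  imports Defs "HOL-Library.Nat_Bijection"
begin

text \<open>
  Fix the standard basis of \<open>V\<close> and write \<open>e\<^sub>A\<close> for the wedge of the basis vectors with index in \<open>A\<close>.
  Give an index set the weight \<open>\<Sum>i\<in>A. 2^i\<close>.  Distinct sets have distinct weights, and weights add
  over disjoint unions, so they order the \<open>e\<^sub>A\<close> like a monomial order.  A nonzero \<open>u \<in> U\<close> has a leading
  set, the heaviest \<open>A\<close> for which the coefficient of \<open>e\<^sub>A\<close> does not vanish; an element of \<open>U\<close> whose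
  coefficients at all leading sets vanish is zero, so \<open>dim U\<close> is at most the number of leading sets
  (\<open>dim_le_card_leading_sets\<close>).  If \<open>A\<close> leads \<open>u\<close>, \<open>B\<close> leads \<open>w\<close> and \<open>A \<inter> B = {}\<close>, then no other pair
  of terms contributes to \<open>e\<^bsub>A \<union> B\<^esub>\<close> in \<open>u \<and> w\<close>, whose coefficient is therefore nonzero.  So the
  leading sets of \<open>U\<close> and \<open>W\<close> form cross-intersecting families
  (\<open>leading_sets_cross_intersecting\<close>), and the theorem follows from the Matsumoto--Tokushige bound
  for such families of \<open>r\<close>-sets and \<open>s\<close>-sets, \<open>cross_sizes_product\<close>.

  The bound on families is proved by induction on \<open>n\<close>.  As in the compression proof of the
  Kruskal--Katona theorem, both families may be taken to consist of the heaviest sets of their size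
  (\<open>cross_intersecting_final_pair\<close>).  If \<open>n > 2r\<close> and \<open>n > 2s\<close>, delete the smallest point: the
  members containing it and the members avoiding it form four cross-intersecting pairs on \<open>n - 1\<close>
  points (\<open>cross_sizes_split\<close>), and Pascal's rule adds up the four bounds.  If \<open>n = 2r = 2s\<close>, the two
  densities add up to at most \<open>1\<close> (\<open>cross_sizes_density_sum\<close>), so their product is at most \<open>1/4\<close>.

  The remaining case is \<open>n = 2r > 2s\<close>, up to symmetry (\<open>product_bound_half\<close>).  A family of heaviest
  sets contains the star of the largest point or lies in it.  If neither family exceeds the star, the
  bound is immediate; if one does, the other lies in the star, and deleting the largest point gives
  a cross-intersecting pair on \<open>n - 1\<close> points (\<open>cross_sizes_cases\<close>).  At most three such steps lead
  to a pair for which the density bound, or the theorem on fewer points, is strong enough.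
  What remains are real inequalities between densities.
\<close>

section \<open>Compression of cross-intersecting families\<close>

definition layer :: "'a set \<Rightarrow> nat \<Rightarrow> 'a set set"
  where "layer X a = {A. A \<subseteq> X \<and> card A = a}"

definition cross_intersecting :: "'a set set \<Rightarrow> 'a set set \<Rightarrow> bool"
  where "cross_intersecting F G \<longleftrightarrow> (\<forall>A\<in>F. \<forall>B\<in>G. A \<inter> B \<noteq> {})"

lemma cross_intersecting_sym: "cross_intersecting F G \<longleftrightarrow> cross_intersecting G F"
  unfolding cross_intersecting_def by (metis inf_commute)

lemma finite_layer [simp]: "finite X \<Longrightarrow> finite (layer X a)"
  by (auto simp: layer_def intro: finite_subset[of _ "Pow X"])

lemma card_layer: "finite X \<Longrightarrow> card (layer X a) = card X choose a"
  by (simp add: layer_def n_subsets)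

lemma set_encode_less:
  assumes "finite U" "finite V" "U \<noteq> {}" "V \<noteq> {}" "Max V < Max U"
  shows "set_encode V < set_encode U"
proof -
  have "set_encode V \<le> (\<Sum>i<Suc (Max V). 2 ^ i)"
    unfolding set_encode_def using assms by (intro sum_mono2) (auto simp: less_Suc_eq_le)
  also have "\<dots> < 2 ^ Suc (Max V)"
    unfolding lessThan_atLeast0 sum_power2 by simp
  also have "\<dots> \<le> 2 ^ Max U"
    using assms(5) by (intro power_increasing) auto
  also have "\<dots> \<le> set_encode U"
    unfolding set_encode_def using assms by (intro member_le_sum) auto
  finally show ?thesis .
qed

lemma Max_less_if_set_encode_less:
  assumes "finite U" "finite V" "U \<inter> V = {}" "V \<noteq> {}" "set_encode V < set_encode U"
  shows "U \<noteq> {}" "Max V < Max U"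
proof -
  show ne: "U \<noteq> {}" using assms(5) by auto
  have "Max U \<in> U" "Max V \<in> V" using assms ne by auto
  then have "Max U \<noteq> Max V" using assms(3) by auto
  moreover have "\<not> Max U < Max V" using set_encode_less[of V U] assms ne by auto
  ultimately show "Max V < Max U" by linarith
qed

lemma set_encode_Un_disjoint:
  "finite A \<Longrightarrow> finite B \<Longrightarrow> A \<inter> B = {} \<Longrightarrow> set_encode (A \<union> B) = set_encode A + set_encode B"
  unfolding set_encode_def by (rule sum.union_disjoint)

text \<open>
  Compression replaces a set \<open>V\<close> by a set \<open>U\<close> of the same size inside the members of a family.  A member moves
  only if its image is new, so the size of the family is preserved.  These are the \<open>UV\<close>-compressions from
  the proof of the Kruskal--Katona theorem.
\<close>
definition compressed :: "'a set \<Rightarrow> 'a set \<Rightarrow> 'a set set \<Rightarrow> bool"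
  where "compressed U V F \<longleftrightarrow> (\<forall>A\<in>F. V \<subseteq> A \<longrightarrow> U \<inter> A = {} \<longrightarrow> (A - V) \<union> U \<in> F)"

definition compress1 :: "'a set \<Rightarrow> 'a set \<Rightarrow> 'a set set \<Rightarrow> 'a set \<Rightarrow> 'a set"
  where "compress1 U V F A =
    (if V \<subseteq> A \<and> U \<inter> A = {} \<and> (A - V) \<union> U \<notin> F then (A - V) \<union> U else A)"

definition compress :: "'a set \<Rightarrow> 'a set \<Rightarrow> 'a set set \<Rightarrow> 'a set set"
  where "compress U V F = compress1 U V F ` F"

lemma inj_on_compress1: "inj_on (compress1 U V F) F"
proof (rule inj_onI)
  fix A B assume A: "A \<in> F" and B: "B \<in> F" and eq: "compress1 U V F A = compress1 U V F B"
  have inv: "C = ((C - V) \<union> U - U) \<union> V" if "V \<subseteq> C" "U \<inter> C = {}" for C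
    using that by auto
  show "A = B"
    using eq A B inv[of A] inv[of B] unfolding compress1_def by (auto split: if_splits)
qed

lemma card_compress: "card (compress U V F) = card F"
  unfolding compress_def by (rule card_image[OF inj_on_compress1])

lemma compress_layer:
  assumes "F \<subseteq> layer X a" "finite X" "U \<subseteq> X" "card U = card V"
  shows "compress U V F \<subseteq> layer X a"
proof -
  have "(A - V) \<union> U \<in> layer X a" if "A \<in> layer X a" "V \<subseteq> A" "U \<inter> A = {}" for A
  proof -
    have fin: "finite A" "finite U" "finite V" 
      using that assms finite_subset[of A X] finite_subset[of U X] finite_subset[of V A]
      by (auto simp: layer_def)
    have "card ((A - V) \<union> U) = card (A - V) + card U"
      using that fin by (intro card_Un_disjoint) auto
    also have "\<dots> = card A"
      using that fin assms(4) card_mono[of A V] by (simp add: card_Diff_subset)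
    finally show ?thesis using that assms by (auto simp: layer_def)
  qed
  then show ?thesis using assms(1) unfolding compress_def compress1_def by auto
qed

text \<open>
  Suppose that the moved set misses \<open>B\<close>.  If \<open>B\<close> contains \<open>V\<close>, then exchanging \<open>V\<close> for \<open>U\<close> in \<open>B\<close>
  gives a member of \<open>G\<close> that misses \<open>A\<close>.  Otherwise \<open>B\<close> misses some \<open>y \<in> V\<close>, and exchanging \<open>V - {y}\<close>
  for some \<open>U - {x}\<close> in \<open>A\<close> gives a member of \<open>F\<close> that misses \<open>B\<close>.
\<close>
lemma moved_meets_fixed:
  assumes cross: "cross_intersecting F G"
    and sub: "\<And>y. y \<in> V \<Longrightarrow> \<exists>x\<in>U. compressed (U - {x}) (V - {y}) F"
    and A: "A \<in> F" "V \<subseteq> A" "U \<inter> A = {}"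
    and B: "B \<in> G" and fixed: "V \<subseteq> B \<Longrightarrow> U \<inter> B = {} \<Longrightarrow> (B - V) \<union> U \<in> G"
    and UV: "U \<inter> V = {}"
  shows "((A - V) \<union> U) \<inter> B \<noteq> {}"
proof
  assume disj: "((A - V) \<union> U) \<inter> B = {}"
  show False
  proof (cases "V \<subseteq> B")
    case True
    have "(B - V) \<union> U \<in> G" using fixed True disj by auto
    then have "A \<inter> ((B - V) \<union> U) \<noteq> {}" using cross A by (auto simp: cross_intersecting_def)
    then show False using disj A by auto
  next
    case False
    then obtain y where y: "y \<in> V" "y \<notin> B" by auto
    obtain x where x: "x \<in> U" "compressed (U - {x}) (V - {y}) F" using sub y by auto
    then have "(A - (V - {y})) \<union> (U - {x}) \<in> F" using A by (auto simp: compressed_def)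
    then have "((A - (V - {y})) \<union> (U - {x})) \<inter> B \<noteq> {}"
      using cross B by (auto simp: cross_intersecting_def)
    then show False using disj y by auto
  qed
qed

text \<open>
  Two moved sets share \<open>U\<close>, two unmoved ones were members before, and the mixed cases are
  \<open>moved_meets_fixed\<close>.
\<close>
lemma cross_intersecting_compress:
  assumes cross: "cross_intersecting F G"
    and subF: "\<And>y. y \<in> V \<Longrightarrow> \<exists>x\<in>U. compressed (U - {x}) (V - {y}) F"
    and subG: "\<And>y. y \<in> V \<Longrightarrow> \<exists>x\<in>U. compressed (U - {x}) (V - {y}) G"
    and UV: "U \<inter> V = {}" "U \<noteq> {}"
  shows "cross_intersecting (compress U V F) (compress U V G)"
  unfolding cross_intersecting_def
proof (intro ballI)
  fix A' B' assume "A' \<in> compress U V F" "B' \<in> compress U V G"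
  then obtain A B where A: "A \<in> F" "A' = compress1 U V F A" and B: "B \<in> G" "B' = compress1 U V G B"
    by (auto simp: compress_def)
  let ?mA = "V \<subseteq> A \<and> U \<inter> A = {} \<and> (A - V) \<union> U \<notin> F"
  let ?mB = "V \<subseteq> B \<and> U \<inter> B = {} \<and> (B - V) \<union> U \<notin> G"
  consider "?mA" "?mB" | "?mA" "\<not> ?mB" | "\<not> ?mA" "?mB" | "\<not> ?mA" "\<not> ?mB" by blast
  then show "A' \<inter> B' \<noteq> {}"
  proof cases
    case 1
    then show ?thesis using A B UV by (auto simp: compress1_def)
  next
    case 2
    then have "((A - V) \<union> U) \<inter> B \<noteq> {}"
      using moved_meets_fixed[OF cross subF _ _ _ B(1) _ UV(1)] A by blast
    then show ?thesis using 2 A B by (simp add: compress1_def if_not_P)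
  next
    case 3
    then have "((B - V) \<union> U) \<inter> A \<noteq> {}"
      using moved_meets_fixed[OF cross[unfolded cross_intersecting_sym[of F]] subG _ _ _ A(1) _ UV(1)] B by blast
    then show ?thesis using 3 A B by (simp add: compress1_def if_not_P Int_commute)
  next
    case 4
    then have "A' = A" "B' = B" using A B unfolding compress1_def by argo+
    then show ?thesis using A B cross by (auto simp: cross_intersecting_def)
  qed
qed

lemma set_encode_compress1:
  assumes "finite A" "finite U" "set_encode V < set_encode U"
  shows "set_encode A \<le> set_encode (compress1 U V F A)"
    and "compress1 U V F A \<noteq> A \<Longrightarrow> set_encode A < set_encode (compress1 U V F A)"
proof -
  have *: "set_encode A < set_encode ((A - V) \<union> U)" if "V \<subseteq> A" "U \<inter> A = {}"
  proof -
    have "set_encode A = set_encode (A - V) + set_encode V"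
      using that assms set_encode_Un_disjoint[of "A - V" V] finite_subset[of V A]
      by (metis Diff_disjoint Diff_partition Un_commute finite_Diff inf_commute)
    also have "\<dots> < set_encode (A - V) + set_encode U" using assms by simp
    also have "\<dots> = set_encode ((A - V) \<union> U)"
      using that assms by (intro set_encode_Un_disjoint[symmetric]) auto
    finally show ?thesis .
  qed
  show "set_encode A \<le> set_encode (compress1 U V F A)"
    using * by (auto simp: compress1_def less_imp_le)
  show "compress1 U V F A \<noteq> A \<Longrightarrow> set_encode A < set_encode (compress1 U V F A)"
    using * by (auto simp: compress1_def split: if_splits)
qed

lemma sum_set_encode_compress:
  assumes F: "finite F" "\<And>A. A \<in> F \<Longrightarrow> finite A" and U: "finite U" "set_encode V < set_encode U"
  shows "sum set_encode F \<le> sum set_encode (compress U V F)"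
    and "\<not> compressed U V F \<Longrightarrow> sum set_encode F < sum set_encode (compress U V F)"
proof -
  have eq: "sum set_encode (compress U V F) = (\<Sum>A\<in>F. set_encode (compress1 U V F A))"
    unfolding compress_def by (simp add: sum.reindex[OF inj_on_compress1])
  show "sum set_encode F \<le> sum set_encode (compress U V F)"
    unfolding eq using set_encode_compress1 assms by (intro sum_mono) auto
  assume "\<not> compressed U V F"
  then obtain A where A: "A \<in> F" "V \<subseteq> A" "U \<inter> A = {}" "(A - V) \<union> U \<notin> F"
    by (auto simp: compressed_def)
  then have "(A - V) \<union> U \<noteq> A" by metis
  then have "compress1 U V F A \<noteq> A" using A by (simp add: compress1_def)
  then have "set_encode A < set_encode (compress1 U V F A)"
    using set_encode_compress1(2) assms A(1) by blast
  then show "sum set_encode F < sum set_encode (compress U V F)"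
    unfolding eq using set_encode_compress1(1) assms A(1)
    by (intro sum_strict_mono_ex1) auto
qed

text \<open>
  Ordering sets by \<open>set_encode\<close> is the colexicographic order; a final segment consists of the heaviest
  sets of size \<open>a\<close>.
\<close>
definition final_in_layer :: "nat set \<Rightarrow> nat \<Rightarrow> nat set set \<Rightarrow> bool"
  where "final_in_layer X a F \<longleftrightarrow> F \<subseteq> layer X a \<and>
    (\<forall>A\<in>F. \<forall>B\<in>layer X a. set_encode A \<le> set_encode B \<longrightarrow> B \<in> F)"

text \<open>
  If \<open>B\<close> is heavier than the member \<open>A\<close>, compression with \<open>U = B - A\<close> and \<open>V = A - B\<close> takes \<open>A\<close> to \<open>B\<close>.
\<close>
lemma final_if_compressed:
  assumes X: "finite X" and F: "F \<subseteq> layer X a"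
    and comp: "\<And>U V. U \<subseteq> X \<Longrightarrow> V \<subseteq> X \<Longrightarrow> U \<inter> V = {} \<Longrightarrow> card U = card V \<Longrightarrow>
      set_encode V < set_encode U \<Longrightarrow> compressed U V F"
  shows "final_in_layer X a F"
  unfolding final_in_layer_def
proof (intro conjI ballI impI)
  show "F \<subseteq> layer X a" by fact
  fix A B assume A: "A \<in> F" and B: "B \<in> layer X a" and le: "set_encode A \<le> set_encode B"
  have AB: "A \<subseteq> X" "B \<subseteq> X" "finite A" "finite B" "card A = card B"
    using A B F X by (auto simp: layer_def intro: finite_subset)
  show "B \<in> F"
  proof (cases "A = B")
    case False
    then have "set_encode A \<noteq> set_encode B" using AB set_encode_eq by blast
    then have lt: "set_encode A < set_encode B" using le by simp
    have "set_encode A = set_encode (A \<inter> B) + set_encode (A - B)"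
      "set_encode B = set_encode (A \<inter> B) + set_encode (B - A)"
      using AB set_encode_Un_disjoint[of "A \<inter> B" "A - B"] set_encode_Un_disjoint[of "A \<inter> B" "B - A"]
      by (metis Int_Diff_Un Int_Diff_disjoint finite_Diff finite_Int Int_commute)+
    with lt have "set_encode (A - B) < set_encode (B - A)" by simp
    moreover have "card (B - A) = card (A - B)"
      using AB by (metis card_Diff_subset_Int finite_Int inf_commute)
    ultimately have "compressed (B - A) (A - B) F"
      using AB by (intro comp) auto
    then have "(A - (A - B)) \<union> (B - A) \<in> F" using A by (auto simp: compressed_def)
    moreover have "(A - (A - B)) \<union> (B - A) = B" by auto
    ultimately show ?thesis by simp
  qed (use A in simp)
qed

text \<open>
  This is the Kruskal--Katona theorem in the language of cross-intersecting families.  Among the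
  cross-intersecting pairs with the given sizes, choose one of maximal total weight.  A compression with
  \<open>U\<close> heavier than \<open>V\<close> increases the weight unless it moves nothing, so the chosen pair admits no such move
  that keeps it cross-intersecting.  Induction on \<open>card U\<close> shows that it admits none at all, because
  \<open>cross_intersecting_compress\<close> asks only for smaller compressions.
\<close>
lemma cross_intersecting_final_pair:
  assumes X: "finite X" and F: "F \<subseteq> layer X a" and G: "G \<subseteq> layer X b" and FG: "cross_intersecting F G"
  obtains F' G' where "final_in_layer X a F'" "final_in_layer X b G'" "cross_intersecting F' G'"
    "card F' = card F" "card G' = card G"
proof -
  define P where "P = (\<lambda>(F', G'). F' \<subseteq> layer X a \<and> G' \<subseteq> layer X b \<and> cross_intersecting F' G' \<and>
    card F' = card F \<and> card G' = card G)"
  define w where "w = (\<lambda>(F', G'). sum set_encode F' + sum set_encode (G' :: nat set set))"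
  have "w p < sum set_encode (layer X a) + sum set_encode (layer X b) + 1" if "P p" for p
    using that X unfolding P_def w_def
    by (auto simp: less_Suc_eq_le intro!: add_mono sum_mono2)
  moreover have "P (F, G)" using assms by (simp add: P_def)
  ultimately obtain p where p: "P p" and max: "\<And>q. P q \<Longrightarrow> w q \<le> w p"
    using ex_has_greatest_nat[of P "(F, G)" w] by blast
  obtain F' G' where p_eq: "p = (F', G')" by (cases p)
  have F': "F' \<subseteq> layer X a" "G' \<subseteq> layer X b" "cross_intersecting F' G'" "card F' = card F" "card G' = card G"
    using p by (auto simp: P_def p_eq)
  have fin: "finite F'" "finite G'" "\<And>A. A \<in> F' \<Longrightarrow> finite A" "\<And>A. A \<in> G' \<Longrightarrow> finite A"
    using F'(1,2) X finite_subset[of _ "layer X _"] by (auto simp: layer_def intro: finite_subset[of _ X])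
  have comp: "compressed U V F' \<and> compressed U V G'"
    if "U \<subseteq> X" "V \<subseteq> X" "U \<inter> V = {}" "card U = card V" "V = {} \<or> set_encode V < set_encode U" for U V
    using that
  proof (induction "card U" arbitrary: U V rule: less_induct)
    case less
    have fUV: "finite U" "finite V" using less.prems X by (auto intro: finite_subset)
    show ?case
    proof (cases "V = {}")
      case True
      then have "U = {}" using less.prems fUV by simp
      then show ?thesis using True by (simp add: compressed_def)
    next
      case False
      then have lt: "set_encode V < set_encode U" using less.prems by simp
      note mx = Max_less_if_set_encode_less[OF fUV less.prems(3) False lt]
      have sub: "compressed (U - {Min U}) (V - {y}) F' \<and> compressed (U - {Min U}) (V - {y}) G'"
        if "y \<in> V" for y
      proof (rule less.hyps)
        have m: "Min U \<in> U" using fUV mx by simp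
        show "card (U - {Min U}) < card U" using m fUV by (meson card_Diff1_less)
        show c: "card (U - {Min U}) = card (V - {y})" using m that less.prems fUV by simp
        \<comment> \<open>Deleting the smallest element of \<open>U\<close> leaves its maximum, which decides the comparison with \<open>V\<close>.\<close>
        show "V - {y} = {} \<or> set_encode (V - {y}) < set_encode (U - {Min U})"
        proof (cases "V - {y} = {}")
          case ne: False
          then have ne': "U - {Min U} \<noteq> {}" using c fUV by (metis card_0_eq finite_Diff)
          then obtain z where z: "z \<in> U" "z \<noteq> Min U" by auto
          have "Max (V - {y}) \<le> Max V" using ne fUV by (intro Max_mono) auto
          also have "Max V < Max U" by (rule mx)
          also have "Max U \<le> Max (U - {Min U})"
          proof (rule Max_ge)
            have "Min U \<le> z" using z fUV by simp
            then have "Min U < Max U" using z fUV Max_ge[of U z] by linarith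
            then show "Max U \<in> U - {Min U}" using mx fUV by simp
          qed (use fUV in auto)
          finally show ?thesis using set_encode_less ne ne' fUV by auto
        qed simp
      qed (use less.prems in auto)
      have mem: "Min U \<in> U" using fUV mx by simp
      have cr: "cross_intersecting (compress U V F') (compress U V G')"
        using sub mem less.prems mx by (intro cross_intersecting_compress F') blast+
      have "P (compress U V F', compress U V G')"
        unfolding P_def using compress_layer[OF F'(1) X less.prems(1,4)]
          compress_layer[OF F'(2) X less.prems(1,4)] cr F' by (simp add: card_compress)
      from max[OF this] have "sum set_encode (compress U V F') + sum set_encode (compress U V G')
          \<le> sum set_encode F' + sum set_encode G'"
        by (simp add: w_def p_eq)
      then show ?thesis
        using sum_set_encode_compress[OF fin(1,3) fUV(1) lt] sum_set_encode_compress[OF fin(2,4) fUV(1) lt]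
        by fastforce
    qed
  qed
  show thesis
    by (rule that[OF final_if_compressed[OF X F'(1)] final_if_compressed[OF X F'(2)] F'(3-5)]) (simp_all add: comp)
qed

section \<open>Sizes of cross-intersecting pairs\<close>

text \<open>
  The ground set is existentially quantified so that deleting a point from it needs no relabelling.
\<close>
definition cross_sizes :: "nat \<Rightarrow> nat \<Rightarrow> nat \<Rightarrow> nat \<Rightarrow> nat \<Rightarrow> bool"
  where "cross_sizes n a b f g \<longleftrightarrow> (\<exists>X F G. finite (X :: nat set) \<and> card X = n \<and>
    F \<subseteq> layer X a \<and> G \<subseteq> layer X b \<and> cross_intersecting F G \<and> card F = f \<and> card G = g)"

lemma cross_sizesI:
  assumes "finite (X :: nat set)" "card X = n" "F \<subseteq> layer X a" "G \<subseteq> layer X b"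
    "cross_intersecting F G" "card F = f" "card G = g"
  shows "cross_sizes n a b f g"
  using assms unfolding cross_sizes_def by blast

lemma cross_sizesE:
  assumes "cross_sizes n a b f g"
  obtains X F G where "finite (X :: nat set)" "card X = n" "F \<subseteq> layer X a" "G \<subseteq> layer X b"
    "cross_intersecting F G" "card F = f" "card G = g"
  using assms unfolding cross_sizes_def by (elim exE conjE)

lemma cross_sizes_sym: "cross_sizes n a b f g \<Longrightarrow> cross_sizes n b a g f"
  by (elim cross_sizesE, rule cross_sizesI) (assumption | subst cross_intersecting_sym)+

lemma cross_sizes_final:
  assumes "cross_sizes n a b f g"
  obtains X F G where "finite X" "card X = n" "final_in_layer X a F" "final_in_layer X b G"
    "cross_intersecting F G" "card F = f" "card G = g"
proof -
  obtain X F G where X: "finite (X :: nat set)" "card X = n" "F \<subseteq> layer X a" "G \<subseteq> layer X b"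
    "cross_intersecting F G" "card F = f" "card G = g"
    by (rule cross_sizesE[OF assms])
  obtain F' G' where F': "final_in_layer X a F'" "final_in_layer X b G'" "cross_intersecting F' G'"
    "card F' = card F" "card G' = card G"
    by (rule cross_intersecting_final_pair[OF X(1,3,4,5)])
  show thesis
    by (rule that[OF X(1,2) F'(1-3)]) (simp_all add: F'(4,5) X(6,7))
qed

lemma cross_sizes_le:
  assumes "cross_sizes n a b f g"
  shows "f \<le> n choose a" "g \<le> n choose b"
proof -
  obtain X F G where X: "finite (X :: nat set)" "card X = n" "F \<subseteq> layer X a" "G \<subseteq> layer X b"
    "cross_intersecting F G" "card F = f" "card G = g"
    by (rule cross_sizesE[OF assms])
  show "f \<le> n choose a" "g \<le> n choose b"
    using card_mono[OF _ X(3)] card_mono[OF _ X(4)] X by (simp_all add: card_layer)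
qed

lemma cross_sizes_zero_right:
  assumes "cross_sizes n a 0 f g"
  shows "g \<le> 1" "f = 0 \<or> g = 0"
proof -
  show "g \<le> 1" using cross_sizes_le(2)[OF assms] by simp
  obtain X F G where X: "finite (X :: nat set)" "card X = n" "F \<subseteq> layer X a" "G \<subseteq> layer X 0"
    "cross_intersecting F G" "card F = f" "card G = g"
    by (rule cross_sizesE[OF assms])
  have "F = {}" if "G \<noteq> {}"
  proof -
    obtain B where B: "B \<in> G" using \<open>G \<noteq> {}\<close> by blast
    then have "B \<subseteq> X" "card B = 0" using X(4) by (auto simp: layer_def)
    moreover from this(1) have "finite B" using X(1) finite_subset by blast
    ultimately have "B = {}" by simp
    then show ?thesis using X(5) B by (auto simp: cross_intersecting_def)
  qed
  then show "f = 0 \<or> g = 0" using X(6,7) by (cases "G = {}") auto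
qed

definition star :: "'a \<Rightarrow> 'a set set \<Rightarrow> 'a set set"
  where "star m F = {A \<in> F. m \<in> A}"

definition link :: "'a \<Rightarrow> 'a set set \<Rightarrow> 'a set set"
  where "link m F = (\<lambda>A. A - {m}) ` star m F"

definition avoid :: "'a \<Rightarrow> 'a set set \<Rightarrow> 'a set set"
  where "avoid m F = {A \<in> F. m \<notin> A}"

lemma card_link: "card (link m F) = card (star m F)"
  unfolding link_def by (rule card_image) (auto simp: inj_on_def star_def)

lemma card_star_avoid:
  assumes "finite F"
  shows "card F = card (star m F) + card (avoid m F)"
proof -
  have "card (star m F \<union> avoid m F) = card (star m F) + card (avoid m F)"
    using assms by (intro card_Un_disjoint) (auto simp: star_def avoid_def)
  moreover have "star m F \<union> avoid m F = F" by (auto simp: star_def avoid_def)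
  ultimately show ?thesis by simp
qed

lemma link_layer: "finite X \<Longrightarrow> F \<subseteq> layer X a \<Longrightarrow> link m F \<subseteq> layer (X - {m}) (a - 1)"
  by (auto simp: link_def layer_def star_def card_Diff_singleton_if)

lemma avoid_layer: "F \<subseteq> layer X a \<Longrightarrow> avoid m F \<subseteq> layer (X - {m}) a"
  by (auto simp: avoid_def layer_def)

lemma cross_intersecting_avoid_link:
  assumes "cross_intersecting F G"
  shows "cross_intersecting (avoid m F) (link m G)"
  unfolding cross_intersecting_def
proof (intro ballI)
  fix A B' assume A: "A \<in> avoid m F" and "B' \<in> link m G"
  then obtain B where B: "B \<in> G" "B' = B - {m}" by (auto simp: link_def star_def)
  have "A \<inter> B \<noteq> {}" using assms A B(1) by (auto simp: cross_intersecting_def avoid_def)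
  moreover have "A \<inter> B' = A \<inter> B" using A B(2) by (auto simp: avoid_def)
  ultimately show "A \<inter> B' \<noteq> {}" by simp
qed

lemma cross_intersecting_subset:
  "cross_intersecting F G \<Longrightarrow> F' \<subseteq> F \<Longrightarrow> G' \<subseteq> G \<Longrightarrow> cross_intersecting F' G'"
  unfolding cross_intersecting_def by blast

lemma card_star_layer:
  assumes "finite X" "m \<in> X" "1 \<le> a"
  shows "card (star m (layer X a)) = (card X - 1) choose (a - 1)"
proof -
  have "link m (layer X a) = layer (X - {m}) (a - 1)"
  proof
    show "link m (layer X a) \<subseteq> layer (X - {m}) (a - 1)" by (rule link_layer[OF assms(1) order_refl])
    show "layer (X - {m}) (a - 1) \<subseteq> link m (layer X a)"
    proof
      fix A assume A: "A \<in> layer (X - {m}) (a - 1)"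
      then have "finite A" using assms by (auto simp: layer_def intro: finite_subset)
      moreover have "m \<notin> A" using A by (auto simp: layer_def)
      ultimately have "insert m A \<in> star m (layer X a)" using A assms by (auto simp: layer_def star_def)
      moreover have "A = insert m A - {m}" using A by (auto simp: layer_def)
      ultimately show "A \<in> link m (layer X a)" unfolding link_def by blast
    qed
  qed
  then show ?thesis using assms by (simp add: card_link[symmetric] card_layer)
qed

text \<open>
  A set that contains the largest point is heavier than every set that avoids it.
\<close>
lemma final_star_cases:
  assumes X: "finite X" "X \<noteq> {}" and a: "1 \<le> a" and F: "final_in_layer X a F"
  shows "star (Max X) F = F \<or> star (Max X) (layer X a) \<subseteq> F"
proof (rule disjCI)
  assume "\<not> star (Max X) (layer X a) \<subseteq> F"
  then obtain B where B: "B \<in> layer X a" "Max X \<in> B" "B \<notin> F" by (auto simp: star_def)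
  show "star (Max X) F = F"
  proof (rule ccontr)
    assume "star (Max X) F \<noteq> F"
    then obtain A where A: "A \<in> F" "Max X \<notin> A" by (auto simp: star_def)
    then have AX: "A \<subseteq> X" "card A = a" using F by (auto simp: final_in_layer_def layer_def)
    then have fin: "finite A" "A \<noteq> {}" using X a finite_subset[OF AX(1)] by auto
    have finB: "finite B" "B \<subseteq> X" using B X finite_subset[of B X] by (auto simp: layer_def)
    have "Max A \<in> A" using fin by simp
    then have "Max A \<noteq> Max X" "Max A \<le> Max X" using A AX X by auto
    then have "Max A < Max X" by simp
    also have "Max X \<le> Max B" using finB B by simp
    finally have "set_encode A < set_encode B" using fin finB B by (intro set_encode_less) auto
    then have "set_encode A \<le> set_encode B" by simp
    then show False using F A(1) B(1,3) unfolding final_in_layer_def by blast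
  qed
qed

lemma exists_set_avoiding:
  assumes "finite X" "B \<subseteq> X" "k + card B \<le> card X"
  obtains C where "C \<subseteq> X" "C \<inter> B = {}" "card C = k" "finite C"
proof -
  have "finite B" using assms finite_subset by blast
  then have "k \<le> card (X - B)" using assms by (simp add: card_Diff_subset)
  then obtain C where "C \<subseteq> X - B" "card C = k" "finite C" by (rule obtain_subset_with_card_n)
  then show thesis using that by blast
qed

text \<open>
  A member \<open>B\<close> of \<open>G\<close> that avoids \<open>m\<close> would be disjoint from some member of the star of \<open>m\<close>, because
  \<open>a + b \<le> n\<close> leaves enough room outside \<open>B\<close>.  So \<open>m\<close> can be removed from every member of \<open>G\<close>, and what
  \<open>F\<close> has beyond the star forms a cross-intersecting pair with the result.
\<close>
lemma cross_sizes_peel_star: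
  assumes X: "finite (X :: nat set)" "card X = n" "m \<in> X" and F: "F \<subseteq> layer X a" and G: "G \<subseteq> layer X b"
    and FG: "cross_intersecting F G" and star: "star m (layer X a) \<subseteq> F"
    and ab: "1 \<le> a" "1 \<le> b" "a + b \<le> n"
  shows "(n - 1) choose (a - 1) \<le> card F"
    and "cross_sizes (n - 1) a (b - 1) (card F - ((n - 1) choose (a - 1))) (card G)"
proof -
  have finF: "finite F" "finite G" using F G X finite_subset[of _ "layer X _"] by auto
  have "star m F = star m (layer X a)" using star F by (auto simp: star_def)
  then have sF: "card (star m F) = (n - 1) choose (a - 1)" using card_star_layer[OF X(1,3) ab(1)] X(2) by simp
  have F_split: "card F = card (star m F) + card (avoid m F)" by (rule card_star_avoid[OF finF(1)])
  then show "(n - 1) choose (a - 1) \<le> card F" using sF by simp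
  have "m \<in> B" if B: "B \<in> G" for B
  proof (rule ccontr)
    assume mB: "m \<notin> B"
    have BX: "B \<subseteq> X - {m}" "card B = b" using B G mB by (auto simp: layer_def)
    obtain C where C: "C \<subseteq> X - {m}" "C \<inter> B = {}" "card C = a - 1" "finite C"
      by (rule exists_set_avoiding[OF _ BX(1), of "a - 1"]) (use X BX ab in auto)
    then have "insert m C \<in> star m (layer X a)" using X ab by (auto simp: star_def layer_def card_insert_if)
    then have "insert m C \<in> F" using star by blast
    then have "insert m C \<inter> B \<noteq> {}" using FG B unfolding cross_intersecting_def by blast
    then show False using C mB by auto
  qed
  then have sG: "star m G = G" by (auto simp: star_def)
  show "cross_sizes (n - 1) a (b - 1) (card F - ((n - 1) choose (a - 1))) (card G)"
  proof (rule cross_sizesI)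
    show "finite (X - {m})" "card (X - {m}) = n - 1" using X by simp_all
    show "avoid m F \<subseteq> layer (X - {m}) a" by (rule avoid_layer[OF F])
    show "link m G \<subseteq> layer (X - {m}) (b - 1)" by (rule link_layer[OF X(1) G])
    show "cross_intersecting (avoid m F) (link m G)" by (rule cross_intersecting_avoid_link[OF FG])
    show "card (avoid m F) = card F - ((n - 1) choose (a - 1))" using F_split sF by simp
    show "card (link m G) = card G" using sG by (simp add: card_link)
  qed
qed

text \<open>
  For a pair of final segments, each family contains the star of the largest point or lies in it.
\<close>
lemma cross_sizes_cases [consumes 4, case_names stars left right]:
  assumes cs: "cross_sizes n a b f g" and ab: "1 \<le> a" "1 \<le> b" "a + b \<le> n"
  obtains "f \<le> (n - 1) choose (a - 1)" "g \<le> (n - 1) choose (b - 1)"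
  | f' where "f = ((n - 1) choose (a - 1)) + f'" "cross_sizes (n - 1) a (b - 1) f' g"
  | g' where "g = ((n - 1) choose (b - 1)) + g'" "cross_sizes (n - 1) (a - 1) b f g'"
proof -
  obtain X F G where X: "finite X" "card X = n" and F: "final_in_layer X a F" and G: "final_in_layer X b G"
    and FG: "cross_intersecting F G" "card F = f" "card G = g"
    by (rule cross_sizes_final[OF cs])
  have ne: "X \<noteq> {}" using X ab by auto
  let ?m = "Max X"
  have m: "?m \<in> X" using X ne by simp
  have FX: "F \<subseteq> layer X a" "G \<subseteq> layer X b" using F G by (auto simp: final_in_layer_def)
  note peel = cross_sizes_peel_star[OF X m]
  consider (1) "star ?m (layer X a) \<subseteq> F" | (2) "star ?m (layer X b) \<subseteq> G"
    | (3) "\<not> star ?m (layer X a) \<subseteq> F" "\<not> star ?m (layer X b) \<subseteq> G"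
    by fast
  then show thesis
  proof cases
    case 1
    show thesis
      by (rule that(2)[of "f - ((n - 1) choose (a - 1))"])
        (use peel[OF FX FG(1) 1 ab] FG(2,3) in simp_all)
  next
    case 2
    have GF: "cross_intersecting G F" using FG(1) cross_intersecting_sym[of F G] by simp
    have "cross_sizes (n - 1) b (a - 1) (g - ((n - 1) choose (b - 1))) f"
      "(n - 1) choose (b - 1) \<le> g"
      using peel[OF FX(2,1) GF 2 ab(2,1)] FG ab(3) by (simp_all add: add.commute)
    then show thesis
      by (intro that(3)[OF _ cross_sizes_sym, of "g - ((n - 1) choose (b - 1))"]) simp_all
  next
    case 3
    then have 3: "star ?m F = F" "star ?m G = G"
      using final_star_cases[OF X(1) ne ab(1) F] final_star_cases[OF X(1) ne ab(2) G] by simp_all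
    have "star ?m F \<subseteq> star ?m (layer X a)" "star ?m G \<subseteq> star ?m (layer X b)"
      using FX by (auto simp: star_def)
    then have "F \<subseteq> star ?m (layer X a)" "G \<subseteq> star ?m (layer X b)" using 3 by simp_all
    then have "card F \<le> card (star ?m (layer X a))" "card G \<le> card (star ?m (layer X b))"
      using 3 X by (auto intro!: card_mono simp: star_def)
    then show thesis
      using card_star_layer[OF X(1) m ab(1)] card_star_layer[OF X(1) m ab(2)]
      by (intro that(1)) (simp_all add: X FG)
  qed
qed

text \<open>
  Here the smallest point is deleted.  The members containing it, with the point removed, and the members
  avoiding it give four pairs, and only for the two links cross-intersection is not inherited.  If
  \<open>A\<close> and \<open>B\<close> met in the smallest point alone, some \<open>j\<close> would lie outside \<open>A \<union> B\<close>, because \<open>a + b \<le> n\<close>.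
  Exchanging the smallest point for \<open>j\<close> makes \<open>A\<close> heavier, so the result is a member of \<open>F\<close>, and it misses \<open>B\<close>.
\<close>
lemma cross_sizes_split:
  assumes cs: "cross_sizes n a b f g" and ab: "1 \<le> a" "1 \<le> b" "a + b \<le> n"
  obtains f1 f0 g1 g0 where "f = f1 + f0" "g = g1 + g0"
    "cross_sizes (n - 1) (a - 1) (b - 1) f1 g1" "cross_sizes (n - 1) (a - 1) b f1 g0"
    "cross_sizes (n - 1) a (b - 1) f0 g1" "cross_sizes (n - 1) a b f0 g0"
proof -
  obtain X F G where X: "finite X" "card X = n" and F: "final_in_layer X a F" and G: "final_in_layer X b G"
    and FG: "cross_intersecting F G" "card F = f" "card G = g"
    by (rule cross_sizes_final[OF cs])
  have ne: "X \<noteq> {}" using X ab by auto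
  let ?m = "Min X"
  have m: "?m \<in> X" using X ne by simp
  have FX: "F \<subseteq> layer X a" "G \<subseteq> layer X b" using F G by (auto simp: final_in_layer_def)
  have fin: "finite F" "finite G" using FX X finite_subset[of _ "layer X _"] by auto
  have "cross_intersecting (link ?m F) (link ?m G)"
    unfolding cross_intersecting_def
  proof (intro ballI notI)
    fix A' B' assume "A' \<in> link ?m F" "B' \<in> link ?m G" and disj: "A' \<inter> B' = {}"
    then obtain A B where A: "A \<in> F" "?m \<in> A" "A' = A - {?m}" and B: "B \<in> G" "?m \<in> B" "B' = B - {?m}"
      by (auto simp: link_def star_def)
    have AX: "A \<subseteq> X" "B \<subseteq> X" "card A = a" "card B = b" using A B FX by (auto simp: layer_def)
    then have finAB: "finite A" "finite B" using X finite_subset by auto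
    have AB: "A \<inter> B = {?m}" using A B disj by auto
    have "card (A \<union> B) < card X"
      using card_Un_Int[OF finAB] AB AX X ab by simp
    then obtain j where j: "j \<in> X" "j \<notin> A \<union> B" by (metis AX(1,2) Un_least card_mono finAB finite_UnI leD subsetI)
    let ?A = "insert j A'"
    have "set_encode A = set_encode A' + 2 ^ ?m"
      using A finAB by (simp add: set_encode_def sum.remove[of A ?m] add.commute)
    also have "\<dots> \<le> set_encode A' + 2 ^ j" using j X by simp
    also have "\<dots> = set_encode ?A" using A j finAB by (simp add: set_encode_def)
    finally have "set_encode A \<le> set_encode ?A" .
    moreover have "?A \<in> layer X a"
      using A AX j finAB card_gt_0_iff[of A] by (auto simp: layer_def card_insert_if)
    ultimately have "?A \<in> F" using F A by (auto simp: final_in_layer_def)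
    then have "?A \<inter> B \<noteq> {}" using FG(1) B(1) unfolding cross_intersecting_def by blast
    then show False using AB A j by auto
  qed
  note ll = this
  have la: "cross_intersecting (link ?m F) (avoid ?m G)" "cross_intersecting (avoid ?m F) (link ?m G)"
    using cross_intersecting_avoid_link[OF FG(1)] FG(1)
      cross_intersecting_avoid_link[of G F] cross_intersecting_sym[of G F]
      cross_intersecting_sym[of "link ?m F" "avoid ?m G"] by simp_all
  have aa: "cross_intersecting (avoid ?m F) (avoid ?m G)"
    by (rule cross_intersecting_subset[OF FG(1)]) (auto simp: avoid_def)
  note layers = avoid_layer[OF FX(1), of ?m] avoid_layer[OF FX(2), of ?m]
    link_layer[OF X(1) FX(1), of ?m] link_layer[OF X(1) FX(2), of ?m]
  have X': "finite (X - {?m})" "card (X - {?m}) = n - 1" using X m by simp_all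
  note cI = cross_sizesI[OF X']
  show thesis
  proof (rule that)
    show "f = card (link ?m F) + card (avoid ?m F)" "g = card (link ?m G) + card (avoid ?m G)"
      using card_star_avoid[OF fin(1)] card_star_avoid[OF fin(2)] FG(2,3) by (simp_all add: card_link)
    show "cross_sizes (n - 1) (a - 1) (b - 1) (card (link ?m F)) (card (link ?m G))"
      by (rule cI[OF layers(3,4) ll refl refl])
    show "cross_sizes (n - 1) (a - 1) b (card (link ?m F)) (card (avoid ?m G))"
      by (rule cI[OF layers(3,2) la(1) refl refl])
    show "cross_sizes (n - 1) a (b - 1) (card (avoid ?m F)) (card (link ?m G))"
      by (rule cI[OF layers(1,4) la(2) refl refl])
    show "cross_sizes (n - 1) a b (card (avoid ?m F)) (card (avoid ?m G))"
      by (rule cI[OF layers(1,2) aa refl refl])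
  qed
qed

section \<open>The product bound for cross-intersecting families\<close>

lemma star_count_eq:
  assumes "1 \<le> a" "1 \<le> n"
  shows "real ((n - 1) choose (a - 1)) = a / n * real (n choose a)"
proof -
  have "real a * real (n choose a) = real n * real ((n - 1) choose (a - 1))"
    using times_binomial_minus1_eq[of a n] assms by (metis of_nat_mult less_eq_Suc_le One_nat_def)
  then show ?thesis using assms by (simp add: field_simps)
qed

lemma costar_count_eq:
  assumes "a \<le> n" "1 \<le> n"
  shows "real ((n - 1) choose a) = (n - a) / n * real (n choose a)"
proof -
  have "real (n - a) * real (n choose a) = real n * real ((n - 1) choose a)"
    using binomial_absorb_comp[of n a] by (metis of_nat_mult)
  then show ?thesis using assms by (simp add: field_simps of_nat_diff)
qed

text \<open>
  This is the local LYM inequality in the language of cross-intersecting families.  In the step, suppose that the first family contains a star and let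
  \<open>\<alpha>\<close>, \<open>\<beta>\<close> be the densities of the reduced pair.  The densities of the pair itself are
  \<open>a/n + \<alpha> (n - a)/n\<close> and \<open>\<beta> b/n\<close>, where \<open>b/n \<le> (n - a)/n\<close>, so \<open>\<alpha> + \<beta> \<le> 1\<close> carries over.
\<close>
lemma cross_sizes_density_sum:
  assumes "cross_sizes n a b f g" "a + b \<le> n"
  shows "real f / real (n choose a) + real g / real (n choose b) \<le> 1"
  using assms
proof (induction n arbitrary: a b f g)
  case 0
  then show ?case using cross_sizes_zero_right[of 0 a f g] cross_sizes_le(1)[of 0 a b f g] by auto
next
  case (Suc m)
  define n where "n = Suc m"
  note cs = Suc.prems(1)[folded n_def]
  have pos: "0 < n choose a" "0 < n choose b" using Suc.prems(2) by (simp_all add: n_def)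
  have le: "real f / real (n choose a) \<le> 1" "real g / real (n choose b) \<le> 1"
    using cross_sizes_le[OF cs] pos by (simp_all add: divide_le_eq_1)
  show ?case
  proof (cases "a = 0 \<or> b = 0")
    case True
    then have "f = 0 \<or> g = 0"
      using cross_sizes_zero_right(2)[of n a f g] cross_sizes_zero_right(2)[of n b g f]
        cs cross_sizes_sym[OF cs] by auto
    then show ?thesis using le unfolding n_def[symmetric] by auto
  next
    case False
    then have ab: "1 \<le> a" "1 \<le> b" "a + b \<le> n" using Suc.prems by (simp_all add: n_def)
    have left_case: "real f / real (n choose a) + real g / real (n choose b) \<le> 1"
      if f: "f = ((n - 1) choose (a - 1)) + f'" and cs': "cross_sizes (n - 1) a (b - 1) f' g"
        and ab: "1 \<le> a" "1 \<le> b" "a + b \<le> n" for a b f g f'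
    proof -
      have n: "n - 1 = m" "1 \<le> n" by (simp_all add: n_def)
      have IH: "real f' / real ((n - 1) choose a) + real g / real ((n - 1) choose (b - 1)) \<le> 1"
        unfolding n(1) by (rule Suc.IH) (use cs' ab n in simp_all)
      define \<alpha> \<beta> where "\<alpha> = real f' / real ((n - 1) choose a)"
        and "\<beta> = real g / real ((n - 1) choose (b - 1))"
      have IH': "\<alpha> + \<beta> \<le> 1" using IH by (simp only: \<alpha>_def \<beta>_def)
      have C: "0 < n choose a" "0 < n choose b" "0 < (n - 1) choose a" "0 < (n - 1) choose (b - 1)"
        using ab by simp_all
      have f': "real f' = \<alpha> * ((n - a) / n * real (n choose a))"
        using C(3) costar_count_eq[of a n] ab n unfolding \<alpha>_def by simp
      have "real f = (a / n + \<alpha> * ((n - a) / n)) * real (n choose a)"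
        unfolding f of_nat_add star_count_eq[OF ab(1) n(2)] f' by (simp add: algebra_simps)
      then have fa: "real f / real (n choose a) = a / n + \<alpha> * ((n - a) / n)" using C by simp
      have "real g = \<beta> * (b / n * real (n choose b))"
        using C(4) star_count_eq[of b n] ab n unfolding \<beta>_def by simp
      then have gb: "real g / real (n choose b) = \<beta> * (b / n)" using C by simp
      have "\<beta> * (b / n) \<le> (1 - \<alpha>) * (b / n)"
        using IH' by (intro mult_right_mono) simp_all
      also have "\<dots> \<le> (1 - \<alpha>) * ((n - a) / n)"
      proof (intro mult_left_mono divide_right_mono)
        have "0 \<le> \<beta>" by (simp add: \<beta>_def)
        then show "0 \<le> 1 - \<alpha>" using IH' by simp
      qed (use ab in simp_all)
      finally have "real f / real (n choose a) + real g / real (n choose b) \<le> a / n + (n - a) / n"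
        unfolding fa gb left_diff_distrib mult_1 by linarith
      also have "\<dots> = 1" using n ab by (simp add: field_simps of_nat_diff)
      finally show ?thesis .
    qed
    from cs ab have "real f / real (n choose a) + real g / real (n choose b) \<le> 1"
    proof (cases rule: cross_sizes_cases)
      case stars
      have n1: "1 \<le> n" by (simp add: n_def)
      have "real f \<le> a / n * real (n choose a)" "real g \<le> b / n * real (n choose b)"
        unfolding star_count_eq[OF ab(1) n1, symmetric] star_count_eq[OF ab(2) n1, symmetric]
        using stars by (simp_all only: of_nat_le_iff)
      then have "real f / real (n choose a) \<le> a / n" "real g / real (n choose b) \<le> b / n"
        using pos by (simp_all only: pos_divide_le_eq of_nat_0_less_iff)
      moreover have "real a / n + real b / n = real (a + b) / n" by (simp add: add_divide_distrib)
      moreover have "\<dots> \<le> 1" using ab(3) n1 by (simp add: divide_le_eq_1 del: of_nat_add)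
      ultimately show ?thesis by linarith
    next
      case (left f')
      show ?thesis by (rule left_case[OF left ab])
    next
      case (right g')
      have "real g / real (n choose b) + real f / real (n choose a) \<le> 1"
        by (rule left_case[OF right(1) cross_sizes_sym[OF right(2)]]) (use ab in simp_all)
      then show ?thesis by linarith
    qed
    then show ?thesis by (simp add: n_def)
  qed
qed

text \<open>
  In \<open>product_bound_half\<close>, \<open>K\<close> and \<open>M\<close> are the sizes of stars, the first family exceeds its star by \<open>x\<close>, and
  \<open>y\<close> is the size of the second.  With \<open>v = y / M\<close> the product is at most \<open>K * M * (2 - v) * v\<close>.
\<close>
lemma product_bound_star_plus:
  fixes K M x y :: real
  assumes "0 < K" "0 < M" "0 \<le> y" "x / K + y / M \<le> 1"
  shows "(K + x) * y \<le> K * M"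
proof -
  define v where "v = y / M"
  have y: "y = M * v" using assms by (simp add: v_def)
  have "x \<le> K * (1 - v)" using assms by (simp add: v_def field_simps)
  then have "(K + x) * y \<le> (K + K * (1 - v)) * y" using assms by (intro mult_right_mono) auto
  also have "\<dots> = K * M * (1 - (1 - v)\<^sup>2)" by (simp add: y power2_eq_square algebra_simps)
  also have "\<dots> \<le> K * M * 1" using assms by (intro mult_left_mono) auto
  finally show ?thesis by simp
qed

text \<open>
  The next two lemmas are the analytic core of \<open>product_bound_half\<close>.  Their common conclusion is the
  product bound on \<open>2 p + 2\<close> points, written in the densities \<open>u\<close>, \<open>v\<close> of the pair on \<open>2 p\<close> points that
  is left after two deletions.  Here the first family
  lies in a star, so that \<open>u \<le> 1 / 2\<close>; the bound on \<open>u * v\<close> is the theorem on \<open>2 p\<close> points, and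
  \<open>v\<close> is eliminated by it and by \<open>v \<le> 1 - u\<close>.
\<close>
lemma half_ineq_small:
  fixes p q u v :: real
  assumes pq: "1 \<le> q" "q \<le> p" and u: "0 \<le> u" "u \<le> 1 / 2" and v: "0 \<le> v" "u + v \<le> 1"
    and uv: "u * v \<le> q / (4 * p)"
  shows "(p + (p + 1) * u) * (1 + (2 * p + 1 - q) / (2 * p + 1) * v) \<le> 2 * p + 1"
proof -
  define h where "h = (2 * p + 1 - q) / (2 * p + 1)"
  have h: "0 \<le> h" "h \<le> 1" using pq by (simp_all add: h_def field_simps)
  have "(p + (p + 1) * u) * (1 + h * v) = p + (p + 1) * u + p * h * v + (p + 1) * h * (u * v)"
    by (simp add: algebra_simps)
  also have "\<dots> \<le> p + (p + 1) * u + p * h * (1 - u) + (p + 1) * h * (q / (4 * p))"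
    using pq h u v uv by (intro add_mono mult_left_mono order_refl) auto
  also have "\<dots> = p + p * h + (p + 1 - p * h) * u + (p + 1) * h * (q / (4 * p))"
    by (simp add: algebra_simps)
  also have "\<dots> \<le> p + p * h + (p + 1 - p * h) * (1 / 2) + (p + 1) * h * (q / (4 * p))"
  proof -
    have "p * h \<le> p" using pq h by (simp add: mult_left_le)
    then have "p * h \<le> p + 1" by simp
    moreover have "0 \<le> (p + 1) * h" using pq h by simp
    ultimately show ?thesis using pq u by (intro add_mono mult_left_mono order_refl) auto
  qed
  also have "\<dots> \<le> 2 * p + 1"
  proof -
    \<comment> \<open>Complete the square in \<open>q\<close>.\<close>
    have "q * (3 * p + 1 - (p + 1) * q) * (4 * (p + 1)) = (3 * p + 1)\<^sup>2 - (2 * (p + 1) * q - (3 * p + 1))\<^sup>2"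
      by (simp add: algebra_simps power2_eq_square)
    also have "\<dots> \<le> (3 * p + 1)\<^sup>2" by simp
    finally have sq: "q * (3 * p + 1 - (p + 1) * q) \<le> (3 * p + 1)\<^sup>2 / (4 * (p + 1))"
      using pq by (simp add: le_divide_eq)
    have "p * 1 \<le> p * p" using pq by (intro mult_left_mono) auto
    then have pp: "p \<le> p\<^sup>2" by (simp add: power2_eq_square)
    have p3: "0 \<le> p ^ 3" using pq by simp
    have "(4 * p\<^sup>2 + 2 * p) * (4 * (p + 1)) - (3 * p + 1)\<^sup>2 = 16 * p ^ 3 + 15 * p\<^sup>2 + 2 * p - 1"
      by (simp add: power2_eq_square power3_eq_cube algebra_simps)
    then have "(3 * p + 1)\<^sup>2 \<le> (4 * p\<^sup>2 + 2 * p) * (4 * (p + 1))"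
      using pp p3 pq by linarith
    then have "(3 * p + 1)\<^sup>2 / (4 * (p + 1)) \<le> 4 * p\<^sup>2 + 2 * p" using pq by (simp add: divide_le_eq)
    with sq have key: "q * (3 * p + 1 - (p + 1) * q) \<le> 4 * p\<^sup>2 + 2 * p" by linarith
    have "h * (2 * p\<^sup>2 + (p + 1) * q) \<le> 2 * p * (p + 1)"
    proof -
      have "(2 * p + 1 - q) * (2 * p\<^sup>2 + (p + 1) * q) \<le> 2 * p * (p + 1) * (2 * p + 1)"
        using key by (simp add: power2_eq_square algebra_simps)
      then show ?thesis using pq by (simp add: h_def divide_le_eq)
    qed
    then have le: "p * h / 2 + (p + 1) * h * (q / (4 * p)) \<le> (p + 1) / 2"
      using pq by (simp add: field_simps power2_eq_square)
    have "p + x + (p + 1 - x) * (1 / 2) + y = p + (p + 1) / 2 + (x / 2 + y)" for x y :: real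
      by (simp add: field_simps)
    also have "p + (p + 1) / 2 + (p * h / 2 + (p + 1) * h * (q / (4 * p))) \<le> p + (p + 1) / 2 + (p + 1) / 2"
      by (rule add_left_mono[OF le])
    also have "\<dots> = 2 * p + 1" by (simp add: field_simps)
    finally show ?thesis .
  qed
  finally show ?thesis by (simp add: h_def)
qed

text \<open>
  Here the first family contains a star, so that \<open>u = (1 + t) / 2\<close> and \<open>v = q w / (2 p)\<close> with the
  densities \<open>t\<close>, \<open>w\<close> of a pair on \<open>2 p - 1\<close> points.
\<close>
lemma half_ineq_large:
  fixes p q t w :: real
  assumes pq: "1 \<le> q" "q \<le> p" and t: "0 \<le> t" "t + w \<le> 1" "0 \<le> w"
  shows "(p + (p + 1) * ((1 + t) / 2)) * (1 + (2 * p + 1 - q) / (2 * p + 1) * (q / (2 * p) * w)) \<le> 2 * p + 1"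
proof -
  define k where "k = (2 * p + 1 - q) * q / (2 * p)"
  have k: "0 \<le> k" using pq by (simp add: k_def)
  have "q * (2 * p + 1 - q) \<le> p * (p + 1)"
  proof -
    have "0 \<le> (p - q) * (p - q + 1)" using pq by simp
    also have "\<dots> = p * (p + 1) - q * (2 * p + 1 - q)" by (simp add: algebra_simps)
    finally show ?thesis by simp
  qed
  then have k': "k \<le> (p + 1) / 2" using pq by (simp add: k_def field_simps)
  have "(p + (p + 1) * ((1 + t) / 2)) \<le> (2 * p + 1) - (p + 1) / 2 * w"
  proof -
    have "(p + 1) * t \<le> (p + 1) * (1 - w)" using t pq by (intro mult_left_mono) auto
    then show ?thesis by (simp add: field_simps)
  qed
  also have "\<dots> \<le> (2 * p + 1) - k * w" using mult_right_mono[OF k' t(3)] by simp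
  finally have "(p + (p + 1) * ((1 + t) / 2)) * (1 + k * w / (2 * p + 1)) \<le> ((2 * p + 1) - k * w) * (1 + k * w / (2 * p + 1))"
    using k t pq by (intro mult_right_mono) auto
  also have "\<dots> = (2 * p + 1) - (k * w)\<^sup>2 / (2 * p + 1)"
    using pq by (simp add: field_simps power2_eq_square)
  also have "\<dots> \<le> 2 * p + 1" using pq by simp
  finally show ?thesis by (simp add: k_def algebra_simps)
qed


text \<open>
  The third deletion of the largest point.  For \<open>q = 0\<close> one of the families is empty; otherwise the
  position of the first family relative to the star selects one of the two preceding inequalities.
\<close>
lemma product_bound_half_base:
  assumes cs: "cross_sizes (2 * p) p q f g" and qp: "q < p"
    and T: "\<And>f g. 1 \<le> q \<Longrightarrow> cross_sizes (2 * p) p q f g \<Longrightarrow>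
      f * g \<le> ((2 * p - 1) choose (p - 1)) * ((2 * p - 1) choose (q - 1))"
  defines "u \<equiv> real f / real ((2 * p) choose p)" and "v \<equiv> real g / real ((2 * p) choose q)"
  shows "(p + (p + 1) * u) * (1 + (2 * p + 1 - q) / (2 * p + 1) * v) \<le> 2 * p + 1"
proof -
  have p: "1 \<le> p" "1 \<le> 2 * p" "2 * p - p = p" using qp by simp_all
  have rq: "real (2 * p + 1 - q) = 2 * real p + 1 - real q" using qp by (simp add: of_nat_diff)
  define K M where "K = real ((2 * p) choose p)" and "M = real ((2 * p) choose q)"
  have K: "0 < K" and M: "0 < M" using qp by (simp_all add: K_def M_def)
  have uv: "u + v \<le> 1" "0 \<le> u" "0 \<le> v"
    using cross_sizes_density_sum[OF cs] qp by (simp_all add: u_def v_def)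
  have starK: "real ((2 * p - 1) choose (p - 1)) = K / 2"
    using star_count_eq[of p "2 * p"] p by (simp add: K_def)
  have starK': "real ((2 * p - 1) choose p) = K / 2"
    using costar_count_eq[of p "2 * p"] p by (simp add: K_def)
  show ?thesis
  proof (cases "q = 0")
    case True
    from cross_sizes_zero_right(2)[of "2 * p" p f g] cs True have "f = 0 \<or> g = 0" by simp
    then consider "u = 0" | "v = 0" by (auto simp: u_def v_def)
    then show ?thesis
    proof cases
      case 1
      then have "p * v \<le> p" using uv by (simp add: mult_left_le)
      then show ?thesis using 1 True by (simp add: algebra_simps)
    next
      case 2
      then have "(real p + 1) * u \<le> real p + 1" using uv by (intro mult_left_le) simp_all
      then show ?thesis using 2 by (simp add: algebra_simps)
    qed
  next
    case False
    then have q: "1 \<le> q" by simp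
    have starM: "real ((2 * p - 1) choose (q - 1)) = q / (2 * p) * M"
      using star_count_eq[of q "2 * p"] q p by (simp add: M_def)
    have pq: "1 \<le> real q" "real q \<le> real p" using q qp by simp_all
    have small: ?thesis if "f \<le> (2 * p - 1) choose (p - 1)"
    proof -
      have "real f \<le> K / 2" unfolding starK[symmetric] using that by (simp only: of_nat_le_iff)
      then have "real f / K \<le> 1 / 2" using K by (simp add: field_simps)
      then have u: "u \<le> 1 / 2" by (simp only: u_def K_def)
      have "real (f * g) \<le> real (((2 * p - 1) choose (p - 1)) * ((2 * p - 1) choose (q - 1)))"
        using T[OF q cs] by (simp only: of_nat_le_iff)
      then have "real f * real g \<le> K / 2 * (q / (2 * p) * M)"
        unfolding of_nat_mult[of f g] of_nat_mult[of "(2 * p - 1) choose (p - 1)"] starK starM .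
      moreover have "real f = u * K" "real g = v * M"
        using K M by (simp_all add: u_def v_def K_def M_def)
      ultimately have "(u * v) * (K * M) \<le> q / (4 * p) * (K * M)" by (simp add: field_simps)
      then have "u * v \<le> q / (4 * p)" using K M mult_pos_pos[OF K M] by (simp only: mult_le_cancel_right_pos)
      then show ?thesis using half_ineq_small[OF pq uv(2) u uv(3,1)] unfolding rq by (simp add: add.commute)
    qed
    have "p + q \<le> 2 * p" using qp by simp
    from cs p(1) q this show ?thesis
    proof (cases rule: cross_sizes_cases)
      case stars
      show ?thesis by (rule small[OF stars(1)])
    next
      case (right g')
      show ?thesis by (rule small[OF cross_sizes_le(1)[OF right(2)]])
    next
      case (left f')
      define t w where "t = real f' / real ((2 * p - 1) choose p)"
        and "w = real g / real ((2 * p - 1) choose (q - 1))"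
      have tw: "0 \<le> t" "t + w \<le> 1" "0 \<le> w"
        using cross_sizes_density_sum[OF left(2)] q qp by (simp_all add: t_def w_def)
      have "real f = K / 2 + t * (K / 2)"
        unfolding left(1) of_nat_add starK t_def starK' using K by simp
      then have "real f / K = (1 + t) / 2" using K by (simp add: field_simps)
      then have u: "u = (1 + t) / 2" by (simp only: u_def K_def)
      have "real g = w * (q / (2 * p) * M)"
        unfolding w_def starM using M q p by simp
      then have v: "v = q / (2 * p) * w" using M by (simp add: v_def M_def[symmetric])
      show ?thesis unfolding u v rq using half_ineq_large[OF pq tw] by (simp add: add.commute)
    qed
  qed
qed

text \<open>
  With \<open>a = p + 1\<close> and \<open>b = q + 1\<close>, the first deletion of the largest point leaves \<open>2 p + 1\<close> points and
  stars of sizes \<open>K\<close> and \<open>M\<close>.  If it is the first family that exceeds its star, the density bound suffices.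
  If it is the second, by \<open>g'\<close>, the goal is \<open>f * (M + g') \<le> K * M\<close>, and the largest remaining point is
  deleted.  If \<open>f\<close> is at most the size \<open>K1\<close> of a star, \<open>f * g'\<close> is bounded by the theorem on
  \<open>2 p + 1\<close> points.  Otherwise \<open>product_bound_half_base\<close> applies to the pair on \<open>2 p\<close> points.
\<close>
lemma product_bound_half:
  assumes cs: "cross_sizes (2 * a) a b f g" and ab: "1 \<le> b" "b < a"
    and T1: "\<And>f g. cross_sizes (2 * a - 1) (a - 1) b f g \<Longrightarrow>
      f * g \<le> ((2 * a - 2) choose (a - 2)) * ((2 * a - 2) choose (b - 1))"
    and T2: "\<And>f g. 2 \<le> b \<Longrightarrow> cross_sizes (2 * a - 2) (a - 1) (b - 1) f g \<Longrightarrow>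
      f * g \<le> ((2 * a - 3) choose (a - 2)) * ((2 * a - 3) choose (b - 2))"
  shows "f * g \<le> ((2 * a - 1) choose (a - 1)) * ((2 * a - 1) choose (b - 1))"
proof -
  obtain p q where pq: "a = Suc p" "b = Suc q" using ab by (metis Suc_le_D less_imp_Suc_add One_nat_def)
  have qp: "q < p" using ab pq by simp
  then have p: "1 \<le> p" by simp
  define K M where "K = (2 * p + 1) choose p" and "M = (2 * p + 1) choose q"
  have KM: "0 < K" "0 < M" using qp by (simp_all add: K_def M_def)
  have K_sym: "(2 * p + 1) choose (p + 1) = K"
    using binomial_symmetric[of p "2 * p + 1"] by (simp add: K_def)
  have goal_eq: "((2 * a - 1) choose (a - 1)) * ((2 * a - 1) choose (b - 1)) = K * M"
    by (simp add: pq K_def M_def)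
  have "1 \<le> a" "a + b \<le> 2 * a" using ab by simp_all
  note side = this(1) ab(1) this(2)
  from cs side show ?thesis unfolding goal_eq
  proof (cases rule: cross_sizes_cases)
    case stars
    then show "f * g \<le> K * M" using mult_le_mono[OF stars] by (simp add: pq K_def M_def)
  next
    case (left f')
    have f: "f = K + f'" using left(1) by (simp add: pq K_def)
    have cs': "cross_sizes (2 * p + 1) (p + 1) q f' g" using left(2) by (simp add: pq)
    have "(real K + real f') * real g \<le> real K * real M"
      by (rule product_bound_star_plus)
        (use KM cross_sizes_density_sum[OF cs'] qp in \<open>simp_all add: K_sym[simplified] M_def\<close>)
    then show "f * g \<le> K * M" unfolding f by (simp only: of_nat_le_iff flip: of_nat_mult of_nat_add)
  next
    case (right g')
    have g: "g = M + g'" using right(1) by (simp add: pq M_def)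
    have cs': "cross_sizes (2 * p + 1) p (Suc q) f g'" using right(2) by (simp add: pq)
    define K1 K2 M1 where "K1 = (2 * p) choose (p - 1)" and "K2 = (2 * p) choose p" and "M1 = (2 * p) choose q"
    have K1: "real K1 = p / (2 * p + 1) * K" using star_count_eq[of p "2 * p + 1"] p by (simp add: K1_def K_def)
    have K2: "real K2 = (p + 1) / (2 * p + 1) * K"
      using costar_count_eq[of p "2 * p + 1"] p by (simp add: K2_def K_def add.commute)
    have M1: "real M1 = (2 * p + 1 - q) / (2 * p + 1) * M"
      using costar_count_eq[of q "2 * p + 1"] qp by (simp add: M1_def M_def)
    have small: "f * g \<le> K * M" if "f \<le> K1"
    proof -
      have "f * g' \<le> K1 * M1"
        using T1[of f g'] cs' by (simp add: pq K1_def M1_def)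
      also have "\<dots> \<le> K2 * M"
      proof (intro mult_le_mono)
        show "K1 \<le> K2" unfolding K1_def K2_def by (rule binomial_maximum')
        show "M1 \<le> M" unfolding M1_def M_def by (rule binomial_right_mono) simp
      qed
      moreover have "f * M \<le> K1 * M" using that by simp
      moreover have "K = K1 + K2"
        using p binomial_Suc_Suc[of "2 * p" "p - 1"] by (simp add: K_def K1_def K2_def)
      ultimately have "f * M + f * g' \<le> K1 * M + K2 * M" "K1 * M + K2 * M = K * M"
        by (linarith, simp add: distrib_right)
      then show ?thesis unfolding g distrib_left by simp
    qed
    have "1 \<le> Suc q" "p + Suc q \<le> 2 * p + 1" using qp by simp_all
    from cs' p this show "f * g \<le> K * M"
    proof (cases rule: cross_sizes_cases)
      case stars
      then show ?thesis using small unfolding goal_eq by (simp add: K1_def)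
    next
      case (right g'')
      then show ?thesis using small cross_sizes_le(1)[OF right(2)] unfolding goal_eq by (simp add: K1_def)
    next
      case (left f')
      have f: "f = K1 + f'" using left(1) by (simp add: K1_def)
      have cs'': "cross_sizes (2 * p) p q f' g'" using left(2) by simp
      define u v where "u = real f' / real K2" and "v = real g' / real M1"
      have R: "(p + (p + 1) * u) * (1 + (2 * p + 1 - q) / (2 * p + 1) * v) \<le> 2 * p + 1"
        unfolding u_def v_def K2_def M1_def
        by (rule product_bound_half_base[OF cs'' qp]) (use T2 in \<open>simp add: pq\<close>)
      have pos: "0 < K2" "0 < M1" using qp by (simp_all add: K2_def M1_def)
      have "real f = K / (2 * p + 1) * (p + (p + 1) * u)"
      proof -
        have "real f' = u * ((p + 1) / (2 * p + 1) * K)"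
          using pos unfolding K2[symmetric] u_def by simp
        then show ?thesis unfolding f of_nat_add K1 by (simp add: field_simps)
      qed
      moreover have "real g = M * (1 + (2 * p + 1 - q) / (2 * p + 1) * v)"
      proof -
        have "real g' = v * ((2 * p + 1 - q) / (2 * p + 1) * M)"
          using pos unfolding M1[symmetric] v_def by simp
        then show ?thesis unfolding g of_nat_add by (simp add: algebra_simps)
      qed
      ultimately have "real f * real g = K * M / (2 * p + 1) *
          ((p + (p + 1) * u) * (1 + (2 * p + 1 - q) / (2 * p + 1) * v))" by simp
      also have "\<dots> \<le> K * M / (2 * p + 1) * (2 * p + 1)" by (rule mult_left_mono[OF R]) simp
      also have "\<dots> = real K * real M" by simp
      finally show ?thesis by (simp only: of_nat_le_iff flip: of_nat_mult)
    qed
  qed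
qed

text \<open>
  For \<open>n \<ge> 1\<close>, the number of \<open>a\<close>-subsets of an \<open>n\<close>-set that contain a given point.  The value \<open>0\<close> at \<open>a = 0\<close>, which
  \<open>(n - 1) choose (a - 1)\<close> would miss, makes Pascal's rule hold for \<open>a = 1\<close> as well.
\<close>
definition star_count :: "nat \<Rightarrow> nat \<Rightarrow> nat"
  where "star_count n a = (if a = 0 then 0 else (n - 1) choose (a - 1))"

lemma star_count_rec:
  assumes "2 \<le> n" "1 \<le> a"
  shows "star_count n a = star_count (n - 1) (a - 1) + star_count (n - 1) a"
proof -
  obtain k where n: "n = Suc (Suc k)" using assms(1) by (metis add_2_eq_Suc le_Suc_ex)
  obtain j where a: "a = Suc j" using assms(2) by (cases a) auto
  show ?thesis unfolding n a by (cases j) (simp_all add: star_count_def)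
qed

text \<open>
  Deleting the smallest point preserves \<open>2 * a \<le> n\<close> and \<open>2 * b \<le> n\<close> only if both inequalities are strict.
  The diagonal case \<open>n = 2 * a = 2 * b\<close> and the case \<open>n = 2 * a > 2 * b\<close>, with its mirror image, are therefore separate.
\<close>
theorem cross_sizes_product:
  assumes "cross_sizes n a b f g" "2 * a \<le> n" "2 * b \<le> n"
  shows "f * g \<le> star_count n a * star_count n b"
  using assms
proof (induction n arbitrary: a b f g rule: less_induct)
  case (less n)
  note cs = less.prems(1)
  show ?case
  proof (cases "a = 0 \<or> b = 0")
    case True
    then have "f = 0 \<or> g = 0"
      using cross_sizes_zero_right(2)[of n a f g] cross_sizes_zero_right(2)[of n b g f]
        cs cross_sizes_sym[OF cs] by auto
    then show ?thesis by auto
  next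
    case False
    then have ab: "1 \<le> a" "1 \<le> b" "a + b \<le> n" "2 \<le> n" using less.prems by simp_all
    have half: "f * g \<le> star_count n a * star_count n b"
      if n: "n = 2 * a" and ba: "b < a" "1 \<le> b" and cs: "cross_sizes n a b f g" for a b f g
    proof -
      have "f * g \<le> ((2 * a - 1) choose (a - 1)) * ((2 * a - 1) choose (b - 1))"
      proof (rule product_bound_half)
        show "cross_sizes (2 * a) a b f g" using cs n by simp
        fix f g assume "cross_sizes (2 * a - 1) (a - 1) b f g"
        from less.IH[OF _ this] show "f * g \<le> ((2 * a - 2) choose (a - 2)) * ((2 * a - 2) choose (b - 1))"
          using n ba by (simp add: star_count_def flip: numeral_2_eq_2)
      next
        fix f g assume "2 \<le> b" "cross_sizes (2 * a - 2) (a - 1) (b - 1) f g"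
        from less.IH[OF _ this(2)] show "f * g \<le> ((2 * a - 3) choose (a - 2)) * ((2 * a - 3) choose (b - 2))"
          using n ba \<open>2 \<le> b\<close> by (simp add: star_count_def flip: numeral_2_eq_2 numeral_3_eq_3)
      qed (use ba in simp_all)
      then show ?thesis using ba n by (simp add: star_count_def)
    qed
    consider (big) "2 * a < n" "2 * b < n" | (a) "n = 2 * a" "b < a" | (b) "n = 2 * b" "a < b"
      | (eq) "n = 2 * a" "a = b"
    proof -
      have "(2 * a < n \<and> 2 * b < n) \<or> (n = 2 * a \<and> b < a) \<or> (n = 2 * b \<and> a < b) \<or> (n = 2 * a \<and> a = b)"
        using less.prems(2,3) by linarith
      then show thesis using that by blast
    qed
    then show ?thesis
    proof cases
      case a
      show ?thesis by (rule half[OF a ab(2) cs])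
    next
      case b
      have "g * f \<le> star_count n b * star_count n a" by (rule half[OF b ab(1) cross_sizes_sym[OF cs]])
      then show ?thesis by (simp only: mult.commute)
    next
      case eq
      define K where "K = n choose a"
      have K: "0 < K" using eq by (simp add: K_def)
      have sc: "real (star_count n a) = K / 2"
        using star_count_eq[of a n] ab eq by (simp add: star_count_def K_def)
      have "real f / K + real g / K \<le> 1" using cross_sizes_density_sum[OF cs ab(3)] eq by (simp add: K_def)
      then have le: "real f + real g \<le> K" using K by (simp add: field_simps)
      have "4 * (real f * real g) \<le> (real f + real g)\<^sup>2"
        using zero_le_power2[of "real f - real g"] by (simp add: power2_eq_square algebra_simps)
      also have "\<dots> \<le> (real K)\<^sup>2" using le by (intro power_mono) auto
      finally have "real f * real g \<le> real (star_count n a) * real (star_count n a)"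
        unfolding sc by (simp add: power2_eq_square)
      then have "f * g \<le> star_count n a * star_count n a" by (simp only: of_nat_le_iff flip: of_nat_mult)
      then show ?thesis using eq by simp
    next
      case big
      obtain f1 f0 g1 g0 where f: "f = f1 + f0" and g: "g = g1 + g0" and
        s: "cross_sizes (n - 1) (a - 1) (b - 1) f1 g1" "cross_sizes (n - 1) (a - 1) b f1 g0"
        "cross_sizes (n - 1) a (b - 1) f0 g1" "cross_sizes (n - 1) a b f0 g0"
        by (rule cross_sizes_split[OF cs ab(1-3)])
      let ?s = "star_count (n - 1)"
      have lt: "n - 1 < n" using ab by simp
      have le: "2 * a \<le> n - 1" "2 * b \<le> n - 1" "2 * (a - 1) \<le> n - 1" "2 * (b - 1) \<le> n - 1" using big by simp_all
      have "f * g = f1 * g1 + f1 * g0 + (f0 * g1 + f0 * g0)" by (simp add: f g algebra_simps)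
      also have "\<dots> \<le> ?s (a - 1) * ?s (b - 1) + ?s (a - 1) * ?s b + (?s a * ?s (b - 1) + ?s a * ?s b)"
        by (intro add_mono less.IH[OF lt s(1)] less.IH[OF lt s(2)] less.IH[OF lt s(3)] less.IH[OF lt s(4)] le)
      also have "\<dots> = star_count n a * star_count n b"
        unfolding star_count_rec[OF ab(4,1)] star_count_rec[OF ab(4,2)] by (simp add: algebra_simps)
      finally show ?thesis .
    qed
  qed
qed

section \<open>A volume form on the exterior algebra\<close>

definition index :: "'n::finite \<Rightarrow> nat"
  where "index = (SOME f. bij_betw f UNIV {..<CARD('n)})"

lemma bij_betw_index: "bij_betw (index :: 'n::finite \<Rightarrow> nat) UNIV {..<CARD('n)}"
proof -
  obtain h where "bij_betw h (UNIV :: 'n set) {0..<CARD('n)}"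
    using ex_bij_betw_finite_nat[of "UNIV :: 'n set"] finite_class.finite_UNIV by blast
  then have "bij_betw h (UNIV :: 'n set) {..<CARD('n)}" by (simp only: atLeast0LessThan)
  then show ?thesis
    unfolding index_def by (rule someI[of "\<lambda>f. bij_betw f (UNIV :: 'n set) {..<CARD('n)}"])
qed

lemma inj_index: "inj (index :: 'n::finite \<Rightarrow> nat)"
  by (rule bij_betw_imp_inj_on[OF bij_betw_index])

lemma index_less: "index (i :: 'n::finite) < CARD('n)"
  using bij_betwE[OF bij_betw_index[where 'n = 'n]] by simp

lemma index_surj:
  assumes "k < CARD('n::finite)"
  obtains i :: "'n::finite" where "index i = k"
proof -
  have "k \<in> range (index :: 'n \<Rightarrow> nat)"
    using bij_betw_imp_surj_on[OF bij_betw_index[where 'n = 'n]] assms by simp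
  then show thesis using that by auto
qed

text \<open>
  The exterior algebra is a quotient, so some linear functional is needed to see that the wedge of all
  basis vectors is not zero.  The determinant provides it: a word of \<open>n\<close> vectors is sent to the determinant
  with these rows, every other word to \<open>0\<close>, and the linear extension vanishes on the defining ideal.
\<close>
definition word_det :: "(real ^ 'n::finite) monomial \<Rightarrow> real"
  where "word_det w = (if length (factors w) = CARD('n) then det (\<chi> i. factors w ! index i) else 0)"

definition free_vol :: "(real ^ 'n::finite) free_algebra \<Rightarrow> real"
  where "free_vol x = (\<Sum>w\<in>Poly_Mapping.keys x. Poly_Mapping.lookup x w * word_det w)"

lemma free_vol_superset:
  assumes "finite S" "Poly_Mapping.keys x \<subseteq> S"
  shows "free_vol x = (\<Sum>w\<in>S. Poly_Mapping.lookup x w * word_det w)"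
  unfolding free_vol_def using assms
  by (intro sum.mono_neutral_left) (auto simp: in_keys_iff)

lemma free_vol_0 [simp]: "free_vol 0 = 0"
  by (simp add: free_vol_def)

lemma free_vol_add: "free_vol (x + y) = free_vol x + free_vol y"
proof -
  let ?S = "Poly_Mapping.keys x \<union> Poly_Mapping.keys y"
  have "free_vol (x + y) = (\<Sum>w\<in>?S. Poly_Mapping.lookup (x + y) w * word_det w)"
    by (rule free_vol_superset) (auto simp: Poly_Mapping.keys_add)
  also have "\<dots> = (\<Sum>w\<in>?S. Poly_Mapping.lookup x w * word_det w) + (\<Sum>w\<in>?S. Poly_Mapping.lookup y w * word_det w)"
    by (simp add: lookup_add distrib_right sum.distrib)
  also have "\<dots> = free_vol x + free_vol y"
    by (simp add: free_vol_superset[of ?S x] free_vol_superset[of ?S y])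
  finally show ?thesis .
qed

lemma free_vol_single: "free_vol (Poly_Mapping.single w c) = c * word_det w"
  by (cases "c = 0") (simp_all add: free_vol_def)

lemma free_vol_uminus: "free_vol (- x) = - free_vol x"
  using free_vol_add[of x "- x"] by simp

lemma free_vol_diff: "free_vol (x - y) = free_vol x - free_vol y"
  using free_vol_add[of x "- y"] by (simp add: free_vol_uminus)

lemma free_algebra_induct [case_names zero add single]:
  fixes x :: "'v free_algebra"
  assumes "P 0" "\<And>x y. P x \<Longrightarrow> P y \<Longrightarrow> P (x + y)" "\<And>w c. P (Poly_Mapping.single w c)"
  shows "P x"
proof (induction x rule: update_induct)
  case (update f a b)
  have "Poly_Mapping.update a b f = f + Poly_Mapping.single a b"
    using update by (intro poly_mapping_eqI)
      (auto simp: lookup_update lookup_add lookup_single when_def in_keys_iff)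
  then show ?case using update assms by simp
qed (rule assms)

lemma free_vol_scalar: "free_vol (Poly_Mapping.single 0 c * x) = c * free_vol x"
  by (induction x rule: free_algebra_induct)
    (simp_all add: distrib_left free_vol_add mult_single free_vol_single)

text \<open>
  In \<open>a * x * b\<close> both \<open>a\<close> and \<open>b\<close> are linear combinations of words, so it is enough to multiply by words.
\<close>
lemma free_vol_ideal_reduce:
  fixes x :: "(real ^ 'n::finite) free_algebra"
  assumes "\<And>u t. free_vol (Poly_Mapping.single u 1 * x * Poly_Mapping.single t 1) = 0"
  shows "free_vol (a * x * b) = 0"
proof (induction a rule: free_algebra_induct)
  case (single u c)
  have "free_vol (Poly_Mapping.single u 1 * x * b) = 0"
  proof (induction b rule: free_algebra_induct)
    case (single t d)
    have "Poly_Mapping.single t d = Poly_Mapping.single 0 d * Poly_Mapping.single t 1"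
      by (simp add: mult_single)
    then show ?case using assms[of u t] by (simp add: scalar_left_commute free_vol_scalar)
  qed (simp_all add: distrib_left free_vol_add)
  moreover have "Poly_Mapping.single u c = Poly_Mapping.single 0 c * Poly_Mapping.single u 1"
    by (simp add: mult_single)
  ultimately show ?case by (simp add: mult.assoc free_vol_scalar)
qed (simp_all add: distrib_right free_vol_add)

lemma word_row:
  assumes "index k = length u"
  shows "(\<chi> i. (u @ [x] @ t) ! index i) = (\<chi> i. if i = k then x else (u @ [0] @ t) ! index i)"
proof -
  have "index i \<noteq> length u" if "i \<noteq> k" for i
    using that assms injD[OF inj_index, of i k] by auto
  then show ?thesis using assms by (auto simp: vec_eq_iff nth_append nth_Cons')
qed

lemma word_det_linear:
  fixes u t :: "(real ^ 'n::finite) list"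
  shows "word_det (Monomial (u @ [x + y] @ t)) = word_det (Monomial (u @ [x] @ t)) + word_det (Monomial (u @ [y] @ t))"
    and "word_det (Monomial (u @ [c *\<^sub>R x] @ t)) = c * word_det (Monomial (u @ [x] @ t))"
proof -
  have "word_det (Monomial (u @ [x + y] @ t)) = word_det (Monomial (u @ [x] @ t)) + word_det (Monomial (u @ [y] @ t)) \<and>
    word_det (Monomial (u @ [c *\<^sub>R x] @ t)) = c * word_det (Monomial (u @ [x] @ t))"
  proof (cases "length u + 1 + length t = CARD('n)")
    case True
    then have "length u < CARD('n)" by simp
    then obtain k :: 'n where k: "index k = length u" by (rule index_surj)
    let ?rest = "\<lambda>i. (u @ [0] @ t) ! index i"
    have eq: "word_det (Monomial (u @ [z] @ t)) = det (\<chi> i. if i = k then z else ?rest i)" for z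
      using True unfolding word_det_def monomial.sel word_row[OF k] by simp
    show ?thesis
      unfolding eq
      using det_row_add[of k "\<lambda>_. x" "\<lambda>_. y" ?rest] det_row_mul[of k c "\<lambda>_. x" ?rest]
      unfolding scalar_mult_eq_scaleR by (rule conjI)
  qed (simp add: word_det_def)
  then show "word_det (Monomial (u @ [x + y] @ t)) = word_det (Monomial (u @ [x] @ t)) + word_det (Monomial (u @ [y] @ t))"
    "word_det (Monomial (u @ [c *\<^sub>R x] @ t)) = c * word_det (Monomial (u @ [x] @ t))" by simp_all
qed

lemma word_det_square:
  fixes u t :: "(real ^ 'n::finite) list"
  shows "word_det (Monomial (u @ [x, x] @ t)) = 0"
proof (cases "length u + 2 + length t = CARD('n)")
  case True
  then have "length u < CARD('n)" "Suc (length u) < CARD('n)" by simp_all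
  then obtain k l :: 'n where kl: "index k = length u" "index l = Suc (length u)"
    by (metis index_surj)
  then have "k \<noteq> l" by auto
  moreover have "row k (\<chi> i. (u @ [x, x] @ t) ! index i) = row l (\<chi> i. (u @ [x, x] @ t) ! index i)"
    by (simp add: row_def kl nth_append vec_eq_iff)
  ultimately have "det (\<chi> i. (u @ [x, x] @ t) ! index i) = 0" by (rule det_identical_rows)
  then show ?thesis by (simp add: word_det_def)
qed (simp add: word_det_def)

text \<open>
  The factors \<open>a\<close> and \<open>b\<close> make the statement inductive: closure of the ideal under multiplication is then
  associativity.  On the generators it says that the determinant is linear in each row and vanishes
  if two adjacent rows agree.
\<close>
lemma free_vol_ideal:
  fixes x :: "(real ^ 'n::finite) free_algebra"
  assumes "x \<in> exterior_ideal"
  shows "free_vol (a * x * b) = 0"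
  using assms
proof (induction x arbitrary: a b rule: exterior_ideal.induct)
  case (gen_add v w)
  show ?case
    by (rule free_vol_ideal_reduce)
      (simp add: gen_def mult_single algebra_simps free_vol_add free_vol_diff free_vol_single
        plus_monomial_def word_det_linear(1)[simplified])
next
  case (gen_scaleR c v)
  show ?case
    by (rule free_vol_ideal_reduce)
      (simp add: gen_def mult_single algebra_simps free_vol_diff free_vol_single plus_monomial_def
        zero_monomial_def word_det_linear(2)[simplified])
next
  case (gen_square v)
  show ?case
    by (rule free_vol_ideal_reduce)
      (simp add: gen_def mult_single free_vol_single plus_monomial_def word_det_square[simplified])
next
  case (mult_left x a')
  show ?case using mult_left.IH[of "a * a'" b] by (simp only: mult.assoc)
next
  case (mult_right x a')
  show ?case using mult_right.IH[of a "a' * b"] by (simp only: mult.assoc)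
qed (simp_all add: distrib_left distrib_right free_vol_add)

lift_definition vol :: "(real ^ 'n::finite) exterior \<Rightarrow> real" is free_vol
proof -
  fix x y :: "(real ^ 'n) free_algebra" assume "exterior_rel x y"
  then show "free_vol x = free_vol y"
    using free_vol_ideal[of "x - y" 1 1] by (simp add: exterior_rel_def free_vol_diff)
qed

lemma linear_vol: "linear vol"
  by (rule linearI; transfer) (simp_all add: free_vol_add free_vol_scalar)

lemma prod_list_ext_vec:
  "prod_list (map ext_vec vs) = abs_exterior (Poly_Mapping.single (Monomial vs) 1)"
proof (induction vs)
  case Nil
  show ?case by (simp add: one_exterior_def flip: zero_monomial_def)
next
  case (Cons v vs)
  then show ?case
    by (simp add: ext_vec.abs_eq times_exterior.abs_eq gen_def mult_single plus_monomial_def)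
qed

lemma vol_prod_list:
  "vol (prod_list (map ext_vec vs)) = word_det (Monomial vs)"
  by (simp add: prod_list_ext_vec vol.abs_eq free_vol_single)

section \<open>Wedges of basis vectors\<close>

definition base_word :: "'n::finite list \<Rightarrow> (real ^ 'n) exterior"
  where "base_word xs = prod_list (map ext_vec (map (\<lambda>i. axis i 1) xs))"

lemma base_word_Nil [simp]: "base_word [] = 1"
  by (simp add: base_word_def)

lemma base_word_Cons: "base_word (x # xs) = ext_vec (axis x 1) * base_word xs"
  by (simp add: base_word_def)

lemma base_word_append: "base_word (xs @ ys) = base_word xs * base_word ys"
  by (simp add: base_word_def)

lemma ext_vec_anticommute: "ext_vec v * ext_vec w = - (ext_vec w * ext_vec v)"
proof -
  have "0 = ext_vec (v + w) * ext_vec (v + w)" by (simp add: ext_vec_square)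
  also have "\<dots> = ext_vec v * ext_vec w + ext_vec w * ext_vec v"
    by (simp add: linear_add[OF linear_ext_vec] distrib_left distrib_right ext_vec_square)
  finally show ?thesis by (simp add: eq_neg_iff_add_eq_0)
qed

lemma ext_vec_base_word_commute:
  "ext_vec v * base_word xs = base_word xs * ext_vec v \<or> ext_vec v * base_word xs = - (base_word xs * ext_vec v)"
proof (induction xs)
  case (Cons x xs)
  have "ext_vec v * base_word (x # xs) = - (ext_vec (axis x 1) * (ext_vec v * base_word xs))"
    by (simp add: base_word_Cons ext_vec_anticommute[of v] flip: mult.assoc)
  then show ?case using Cons.IH by (auto simp: base_word_Cons mult.assoc)
qed simp

text \<open>
  Moving one of two equal factors next to the other costs at most a sign.
\<close>
lemma base_word_repeated:
  assumes "\<not> distinct xs"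
  shows "base_word xs = 0"
proof -
  obtain as bs cs y where xs: "xs = as @ [y] @ bs @ [y] @ cs"
    using not_distinct_decomp[OF assms] by auto
  let ?e = "ext_vec (axis y 1 :: real ^ 'a)"
  have "?e * base_word bs * ?e = base_word bs * ?e * ?e \<or> ?e * base_word bs * ?e = - (base_word bs * ?e * ?e)"
    using ext_vec_base_word_commute[of "axis y 1" bs] by (elim disjE) simp_all
  moreover have "base_word bs * ?e * ?e = 0" by (simp only: mult.assoc ext_vec_square mult_zero_right)
  ultimately have "?e * base_word bs * ?e = 0" by simp
  then have "base_word as * (?e * base_word bs * ?e) * base_word cs = 0" by simp
  then show ?thesis by (simp add: xs base_word_append base_word_Cons mult.assoc)
qed

lemma base_word_permuted:
  assumes "mset xs = mset ys"
  shows "base_word xs = base_word ys \<or> base_word xs = - base_word ys"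
  using assms
proof (induction xs arbitrary: ys)
  case (Cons x xs)
  then have "x \<in> set ys" by (metis list.set_intros(1) set_mset_mset)
  then obtain as bs where ys: "ys = as @ x # bs" by (meson split_list)
  with Cons.prems have "mset xs = mset (as @ bs)" by simp
  from Cons.IH[OF this] have "base_word xs = base_word as * base_word bs \<or> base_word xs = - (base_word as * base_word bs)"
    by (simp add: base_word_append)
  moreover have "ext_vec (axis x 1) * base_word as = base_word as * ext_vec (axis x 1) \<or>
      ext_vec (axis x 1) * base_word as = - (base_word as * ext_vec (axis x 1))"
    by (rule ext_vec_base_word_commute)
  ultimately show ?case by (auto simp: ys base_word_Cons base_word_append simp flip: mult.assoc)
qed simp


lemma vol_base_word_nonzero:
  assumes "distinct (xs :: 'n::finite list)" "length xs = CARD('n)"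
  shows "vol (base_word xs) \<noteq> 0"
proof -
  define p where "p = (\<lambda>i::'n. xs ! index i)"
  have "inj p"
  proof (rule injI)
    fix i j assume "p i = p j"
    then have "index i = index j"
      using assms index_less[of i] index_less[of j] by (simp add: p_def nth_eq_iff_index_eq)
    then show "i = j" using injD[OF inj_index] by blast
  qed
  then have "bij p" by (intro bijI finite_UNIV_inj_surj) simp_all
  then have "p permutes UNIV" by (rule bij_imp_permutes) simp
  then have "det (\<chi> i. mat 1 $ p i :: real ^ 'n ^ 'n) = of_int (sign p)"
    by (simp add: det_permute_rows)
  moreover have "(\<chi> i. map (\<lambda>i. axis i 1 :: real ^ 'n) xs ! index i) = (\<chi> i. mat 1 $ p i)"
    using assms index_less[where 'n = 'n] by (auto simp: vec_eq_iff p_def mat_def axis_def)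
  ultimately have "vol (base_word xs) = of_int (sign p)"
    using assms(2) unfolding base_word_def vol_prod_list word_det_def monomial.sel by simp
  then show ?thesis by (simp add: sign_def)
qed

text \<open>
  The order in which the elements of \<open>A\<close> are listed changes the wedge of the basis vectors only by a sign,
  which does not affect whether a coefficient vanishes, so any order will do.
\<close>
definition set_word :: "'n set \<Rightarrow> 'n list"
  where "set_word A = (SOME xs. set xs = A \<and> distinct xs)"

lemma set_word: "set (set_word (A :: 'n::finite set)) = A" "distinct (set_word A)" "length (set_word A) = card A"
proof -
  have *: "set (set_word A) = A \<and> distinct (set_word A)"
    unfolding set_word_def by (rule someI_ex) (simp add: finite_distinct_list)
  then show "set (set_word A) = A" "distinct (set_word A)" by simp_all
  then show "length (set_word A) = card A" using distinct_card by metis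
qed

definition base_wedge :: "'n::finite set \<Rightarrow> (real ^ 'n) exterior"
  where "base_wedge A = base_word (set_word A)"

text \<open>
  If two of the sets meet, the product of the three wedges repeats a basis vector and vanishes.
\<close>
lemma vol_base_wedge3:
  assumes "vol (base_wedge A * base_wedge B * base_wedge (C :: 'n::finite set)) \<noteq> 0"
  shows "A \<inter> B = {}" "(A \<union> B) \<inter> C = {}"
  using assms base_word_repeated[of "set_word A @ set_word B @ set_word C"]
  by (force simp: base_wedge_def base_word_append set_word mult.assoc linear_0[OF linear_vol])+

lemma vol_base_wedge3_nonzero:
  assumes "A \<inter> B = {}" "C = - (A \<union> B :: 'n::finite set)"
  shows "vol (base_wedge A * base_wedge B * base_wedge C) \<noteq> 0"
proof -
  let ?xs = "set_word A @ set_word B @ set_word C"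
  have "distinct ?xs" "set ?xs = UNIV" using assms by (auto simp: set_word)
  then have "length ?xs = CARD('n)" using distinct_card by metis
  from vol_base_word_nonzero[OF \<open>distinct ?xs\<close> this] show ?thesis
    by (simp add: base_wedge_def base_word_append mult.assoc)
qed

lemma base_wedge_empty: "base_wedge {} = 1"
proof -
  have "set_word {} = ([] :: 'a list)" using set_word(1)[of "{} :: 'a set"] by simp
  then show ?thesis by (simp add: base_wedge_def)
qed

lemma base_word_in_sums:
  fixes xs :: "'n::finite list"
  assumes "length xs = r"
  shows "\<exists>c. base_word xs = (\<Sum>A\<in>layer UNIV r. c A *\<^sub>R base_wedge A)"
proof (cases "distinct xs")
  case False
  then show ?thesis by (intro exI[of _ "\<lambda>_. 0"]) (simp add: base_word_repeated)
next
  case True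
  have mem: "set xs \<in> layer UNIV r" using True assms by (simp add: layer_def distinct_card)
  have "mset xs = mset (set_word (set xs))"
    using True by (simp add: set_eq_iff_mset_eq_distinct[symmetric] set_word)
  then have "base_word xs = base_wedge (set xs) \<or> base_word xs = - base_wedge (set xs)"
    unfolding base_wedge_def by (rule base_word_permuted)
  then obtain e :: real where e: "base_word xs = e *\<^sub>R base_wedge (set xs)"
    by (metis scaleR_one scaleR_minus1_left)
  have "(\<Sum>A\<in>layer UNIV r. (if A = set xs then e else 0) *\<^sub>R base_wedge A) = e *\<^sub>R base_wedge (set xs)"
    using mem by (simp add: if_distrib[of "\<lambda>c. c *\<^sub>R _"] sum.delta cong: if_cong)
  then show ?thesis unfolding e by metis
qed

lemma ext_product_in_span:
  fixes vs :: "(real ^ 'n::finite) list"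
  shows "prod_list (map ext_vec vs) \<in> span (base_word ` {xs. length xs = length vs})"
proof (induction vs)
  case Nil
  then show ?case by (simp add: span_base)
next
  case (Cons v vs)
  let ?S = "base_word ` {xs :: 'n list. length xs = Suc (length vs)}"
  have "ext_vec (axis i 1) * y \<in> span ?S" if "y \<in> span (base_word ` {xs. length xs = length vs})" for i y
    using that
  proof (induction rule: span_induct_alt)
    case (step c x y)
    then obtain xs where x: "x = base_word xs" "length xs = length vs" by auto
    then have "ext_vec (axis i 1) * x \<in> span ?S"
      by (intro span_base) (auto intro!: image_eqI[of _ _ "i # xs"] simp: base_word_Cons)
    then show ?case using step by (simp add: distrib_left span_add span_scale)
  qed (simp add: span_zero)
  then have *: "ext_vec (axis i 1) * prod_list (map ext_vec vs) \<in> span ?S" for i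
    using Cons.IH by simp
  have "v = (\<Sum>i\<in>UNIV. (v $ i) *\<^sub>R axis i 1)"
    by (simp add: basis_expansion flip: scalar_mult_eq_scaleR)
  then have "ext_vec v = (\<Sum>i\<in>UNIV. (v $ i) *\<^sub>R ext_vec (axis i 1))"
    by (metis (no_types, lifting) linear_ext_vec linear_sum linear_scale sum.cong)
  then have "prod_list (map ext_vec (v # vs)) = (\<Sum>i\<in>UNIV. (v $ i) *\<^sub>R (ext_vec (axis i 1) * prod_list (map ext_vec vs)))"
    by (simp add: sum_distrib_right)
  then show ?case using * by (simp add: span_sum span_scale)
qed

lemma ext_power_expand:
  fixes u :: "(real ^ 'n::finite) exterior"
  assumes "u \<in> ext_power r"
  obtains c where "u = (\<Sum>A\<in>layer UNIV r. c A *\<^sub>R base_wedge A)"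
proof -
  define Q where "Q = range (\<lambda>c. \<Sum>A\<in>layer UNIV r. c A *\<^sub>R (base_wedge A :: (real ^ 'n) exterior))"
  have "subspace Q"
  proof (rule subspaceI)
    show "0 \<in> Q" unfolding Q_def by (rule image_eqI[of _ _ "\<lambda>_. 0"]) simp_all
    fix x y assume "x \<in> Q" "y \<in> Q"
    then obtain c d where "x = (\<Sum>A\<in>layer UNIV r. c A *\<^sub>R base_wedge A)" "y = (\<Sum>A\<in>layer UNIV r. d A *\<^sub>R base_wedge A)"
      by (auto simp: Q_def)
    then show "x + y \<in> Q"
      unfolding Q_def by (intro image_eqI[of _ _ "\<lambda>A. c A + d A"]) (simp_all add: scaleR_add_left sum.distrib)
  next
    fix k x assume "x \<in> Q"
    then obtain c where "x = (\<Sum>A\<in>layer UNIV r. c A *\<^sub>R base_wedge A)" by (auto simp: Q_def)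
    then show "k *\<^sub>R x \<in> Q"
      unfolding Q_def by (intro image_eqI[of _ _ "\<lambda>A. k * c A"]) (simp_all add: scaleR_sum_right)
  qed
  moreover have "base_word ` {xs. length xs = r} \<subseteq> Q"
    using base_word_in_sums by (auto simp: Q_def)
  ultimately have "span (base_word ` {xs. length xs = r}) \<subseteq> Q" by (intro span_minimal)
  then have "{prod_list (map ext_vec vs) | vs :: (real ^ 'n) list. length vs = r} \<subseteq> Q"
    using ext_product_in_span by blast
  then have "u \<in> Q" using assms \<open>subspace Q\<close> unfolding ext_power_def by (meson span_minimal subsetD)
  then show thesis using that by (auto simp: Q_def)
qed


section \<open>Leading sets\<close>

text \<open>
  The kernel of one functional has codimension at most one, and the common kernel in \<open>U\<close> is zero.
\<close>
lemma dim_le_card_functionals: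
  fixes U :: "'a::real_vector set" and \<kappa> :: "'i \<Rightarrow> 'a \<Rightarrow> real"
  assumes "finite L" "subspace U" "\<And>i. i \<in> L \<Longrightarrow> linear (\<kappa> i)"
    and "\<And>u. u \<in> U \<Longrightarrow> (\<And>i. i \<in> L \<Longrightarrow> \<kappa> i u = 0) \<Longrightarrow> u = 0"
  shows "dim U \<le> card L"
proof -
  have "\<exists>B. finite B \<and> card B \<le> card L \<and> U \<subseteq> span B"
    using assms
  proof (induction L arbitrary: U rule: finite_induct)
    case empty
    then have "U \<subseteq> span {}" by auto
    then show ?case by (intro exI[of _ "{}"]) simp
  next
    case (insert j L)
    have lin: "linear (\<kappa> j)" by (rule insert.prems(2)) simp
    define U' where "U' = {u \<in> U. \<kappa> j u = 0}"
    have "subspace U'"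
      unfolding subspace_def U'_def
      using subspace_0[OF insert.prems(1)] subspace_add[OF insert.prems(1)] subspace_scale[OF insert.prems(1)]
      by (simp add: linear_0[OF lin] linear_add[OF lin] linear_scale[OF lin])
    moreover have "u = 0" if "u \<in> U'" "\<And>i. i \<in> L \<Longrightarrow> \<kappa> i u = 0" for u
      using that by (intro insert.prems(3)) (auto simp: U'_def)
    ultimately obtain B where B: "finite B" "card B \<le> card L" "U' \<subseteq> span B"
      using insert.IH[of U'] insert.prems(2) by auto
    show ?case
    proof (cases "U' = U")
      case True
      then show ?thesis using B insert.hyps by (intro exI[of _ B]) simp
    next
      case False
      then obtain w where w: "w \<in> U" "\<kappa> j w \<noteq> 0" by (auto simp: U'_def)
      have "u \<in> span (insert w B)" if u: "u \<in> U" for u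
      proof -
        let ?k = "\<kappa> j u / \<kappa> j w"
        have "u - ?k *\<^sub>R w \<in> U'"
          using w u insert.prems(1) by (simp add: U'_def subspace_diff subspace_scale linear_diff[OF lin] linear_scale[OF lin])
        then have "u - ?k *\<^sub>R w \<in> span B" using B by blast
        then show ?thesis by (auto simp: span_insert)
      qed
      moreover have "card (insert w B) \<le> card (insert j L)" using B insert.hyps by (simp add: card_insert_if)
      ultimately show ?thesis using B(1) by (intro exI[of _ "insert w B"]) auto
    qed
  qed
  then obtain B where B: "finite B" "card B \<le> card L" "U \<subseteq> span B" by blast
  from dim_le_card[OF B(3,1)] B(2) show ?thesis by linarith
qed

text \<open>
  In degree \<open>card A\<close> this is, up to a nonzero factor, the coefficient of \<open>base_wedge A\<close>: the
  complementary wedge annihilates all other basis elements of the same degree.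
\<close>
definition coord :: "'n set \<Rightarrow> (real ^ 'n::finite) exterior \<Rightarrow> real"
  where "coord A u = vol (u * base_wedge (- A))"

lemma linear_coord: "linear (coord A)"
  by (rule linearI) (simp_all add: coord_def distrib_right linear_add[OF linear_vol] linear_scale[OF linear_vol])

lemma coord_sum:
  fixes c :: "'n::finite set \<Rightarrow> real"
  assumes A: "A \<in> layer UNIV r"
  shows "coord A (\<Sum>B\<in>layer UNIV r. c B *\<^sub>R base_wedge B) = 0 \<longleftrightarrow> c A = 0"
proof -
  have zero: "coord A (base_wedge B) = 0" if B: "B \<in> layer UNIV r" "B \<noteq> A" for B
  proof (rule ccontr)
    assume "coord A (base_wedge B) \<noteq> 0"
    then have "vol (base_wedge B * base_wedge {} * base_wedge (- A)) \<noteq> 0"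
      by (simp add: coord_def base_wedge_empty)
    from vol_base_wedge3(2)[OF this] have "B \<subseteq> A" by auto
    moreover have "card B = card A" using A B by (simp add: layer_def)
    ultimately show False using B card_subset_eq[of A B] by simp
  qed
  have "coord A (\<Sum>B\<in>layer UNIV r. c B *\<^sub>R base_wedge B) = (\<Sum>B\<in>layer UNIV r. c B * coord A (base_wedge B))"
    by (simp add: linear_sum[OF linear_coord] linear_scale[OF linear_coord])
  also have "\<dots> = (\<Sum>B\<in>{A}. c B * coord A (base_wedge B))"
    using A zero by (intro sum.mono_neutral_right) auto
  finally have "coord A (\<Sum>B\<in>layer UNIV r. c B *\<^sub>R base_wedge B) = c A * coord A (base_wedge A)" by simp
  moreover have "coord A (base_wedge A) \<noteq> 0"
    using vol_base_wedge3_nonzero[of A "{}" "- A"] by (simp add: coord_def base_wedge_empty)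
  ultimately show ?thesis by simp
qed

text \<open>
  Additive over disjoint unions and injective, the weight plays the part of a monomial order.
\<close>
definition weight :: "'n::finite set \<Rightarrow> nat"
  where "weight A = set_encode (index ` A)"

lemma weight_inj: "weight A = weight B \<longleftrightarrow> A = B"
  by (simp add: weight_def set_encode_eq inj_image_eq_iff inj_index)

lemma weight_Un: "A \<inter> B = {} \<Longrightarrow> weight (A \<union> B) = weight A + weight B"
  unfolding weight_def image_Un
  by (rule set_encode_Un_disjoint) (simp_all flip: image_Int[OF inj_index])

definition leading_sets :: "nat \<Rightarrow> (real ^ 'n::finite) exterior set \<Rightarrow> 'n set set"
  where "leading_sets r U = {A \<in> layer UNIV r.
    \<exists>u\<in>U. coord A u \<noteq> 0 \<and> (\<forall>B\<in>layer UNIV r. coord B u \<noteq> 0 \<longrightarrow> weight B \<le> weight A)}"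

text \<open>
  A nonzero element has a nonzero coefficient at its own leading set.  So the coefficients at the leading
  sets separate the elements of \<open>U\<close>.
\<close>
lemma dim_le_card_leading_sets:
  fixes U :: "(real ^ 'n::finite) exterior set"
  assumes "subspace U" "U \<subseteq> ext_power r"
  shows "dim U \<le> card (leading_sets r U)"
proof (rule dim_le_card_functionals[where \<kappa> = coord])
  show "finite (leading_sets r U)" by simp
  show "subspace U" by fact
  show "linear (coord A)" for A :: "'n set" by (rule linear_coord)
  fix u assume u: "u \<in> U" and zero: "\<And>A. A \<in> leading_sets r U \<Longrightarrow> coord A u = 0"
  obtain c where c: "u = (\<Sum>A\<in>layer UNIV r. c A *\<^sub>R base_wedge A)"
    using ext_power_expand u assms(2) by blast
  show "u = 0"
  proof (rule ccontr)
    assume "u \<noteq> 0"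
    then obtain A0 where A0: "A0 \<in> layer UNIV r" "c A0 \<noteq> 0"
      unfolding c by (metis (no_types, lifting) scaleR_eq_0_iff sum.neutral)
    define S where "S = {A \<in> layer UNIV r. coord A u \<noteq> 0}"
    have "A0 \<in> S" using A0 coord_sum[OF A0(1), of c] by (simp add: S_def c)
    then have "finite (weight ` S)" "weight ` S \<noteq> {}" by auto
    then have "Max (weight ` S) \<in> weight ` S" by (rule Max_in)
    then obtain A where A: "A \<in> S" "weight A = Max (weight ` S)" by auto
    have "weight B \<le> weight A" if "B \<in> S" for B using that A(2) by simp
    then have "A \<in> leading_sets r U" using A(1) u by (auto simp: leading_sets_def S_def)
    then show False using zero A(1) by (simp add: S_def)
  qed
qed

text \<open>
  Let \<open>A\<close> and \<open>B\<close> be disjoint leading sets of \<open>u\<close> and \<open>w\<close>.  Terms of \<open>u\<close> and \<open>w\<close> at sets \<open>A'\<close> and \<open>B'\<close>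
  contribute to the coefficient of \<open>u * w\<close> at \<open>A \<union> B\<close> only if \<open>A \<union> B\<close> is the disjoint union of \<open>A'\<close> and \<open>B'\<close>.
  Then the weights of \<open>A'\<close> and \<open>B'\<close> have the same sum as those of \<open>A\<close> and \<open>B\<close>, and neither exceeds its
  counterpart, so \<open>A' = A\<close> and \<open>B' = B\<close>.  The single remaining term is not zero.
\<close>
lemma leading_sets_cross_intersecting:
  fixes U W :: "(real ^ 'n::finite) exterior set"
  assumes U: "U \<subseteq> ext_power r" and W: "W \<subseteq> ext_power s"
    and zero: "\<And>u w. u \<in> U \<Longrightarrow> w \<in> W \<Longrightarrow> u * w = 0"
  shows "cross_intersecting (leading_sets r U) (leading_sets s W)"
  unfolding cross_intersecting_def
proof (intro ballI notI)
  fix A B :: "'n set" assume "A \<in> leading_sets r U" "B \<in> leading_sets s W" and AB: "A \<inter> B = {}"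
  then obtain u w where A: "A \<in> layer UNIV r" and u: "u \<in> U" "coord A u \<noteq> 0"
      "\<And>A'. A' \<in> layer UNIV r \<Longrightarrow> coord A' u \<noteq> 0 \<Longrightarrow> weight A' \<le> weight A"
    and B: "B \<in> layer UNIV s" and w: "w \<in> W" "coord B w \<noteq> 0"
      "\<And>B'. B' \<in> layer UNIV s \<Longrightarrow> coord B' w \<noteq> 0 \<Longrightarrow> weight B' \<le> weight B"
    unfolding leading_sets_def by blast
  have "u \<in> ext_power r" "w \<in> ext_power s" using u(1) w(1) U W by auto
  obtain c where c: "u = (\<Sum>A\<in>layer UNIV r. c A *\<^sub>R base_wedge A)"
    by (rule ext_power_expand[OF \<open>u \<in> ext_power r\<close>])
  obtain d where d: "w = (\<Sum>B\<in>layer UNIV s. d B *\<^sub>R base_wedge B)"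
    by (rule ext_power_expand[OF \<open>w \<in> ext_power s\<close>])
  have cA: "c A \<noteq> 0" "\<And>A'. A' \<in> layer UNIV r \<Longrightarrow> c A' \<noteq> 0 \<Longrightarrow> weight A' \<le> weight A"
    using u coord_sum[of _ r c] A unfolding c by simp_all
  have dB: "d B \<noteq> 0" "\<And>B'. B' \<in> layer UNIV s \<Longrightarrow> d B' \<noteq> 0 \<Longrightarrow> weight B' \<le> weight B"
    using w coord_sum[of _ s d] B unfolding d by simp_all
  let ?C = "- (A \<union> B)"
  let ?v = "\<lambda>A' B'. vol (base_wedge A' * base_wedge B' * base_wedge ?C)"
  let ?I = "layer UNIV r \<times> layer UNIV s"
  have other: "c A' * d B' * ?v A' B' = 0"
    if A': "A' \<in> layer UNIV r" and B': "B' \<in> layer UNIV s" and ne: "(A', B') \<noteq> (A, B)" for A' B'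
  proof (rule ccontr)
    assume "c A' * d B' * ?v A' B' \<noteq> 0"
    then have nz: "c A' \<noteq> 0" "d B' \<noteq> 0" "?v A' B' \<noteq> 0" by simp_all
    note disj = vol_base_wedge3[OF nz(3)]
    have sub: "A' \<union> B' \<subseteq> A \<union> B" using disj(2) by auto
    have "card (A' \<union> B') = card (A \<union> B)"
      using A B A' B' AB disj(1) by (simp add: card_Un_disjoint layer_def)
    with sub have "A' \<union> B' = A \<union> B" by (intro card_subset_eq) simp_all
    then have "weight A' + weight B' = weight A + weight B"
      using weight_Un[OF disj(1)] weight_Un[OF AB] by simp
    moreover have "weight A' \<le> weight A" "weight B' \<le> weight B"
      using cA(2)[OF A' nz(1)] dB(2)[OF B' nz(2)] by simp_all
    ultimately have "weight A' = weight A" "weight B' = weight B" by linarith+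
    then show False using ne by (simp add: weight_inj)
  qed
  have "u * w = (\<Sum>A'\<in>layer UNIV r. \<Sum>B'\<in>layer UNIV s. (c A' * d B') *\<^sub>R (base_wedge A' * base_wedge B'))"
    unfolding c d sum_product by (simp add: mult.commute)
  then have "u * w * base_wedge ?C = (\<Sum>A'\<in>layer UNIV r. \<Sum>B'\<in>layer UNIV s.
      (c A' * d B') *\<^sub>R (base_wedge A' * base_wedge B' * base_wedge ?C))"
    by (simp add: sum_distrib_right)
  then have "vol (u * w * base_wedge ?C) = (\<Sum>A'\<in>layer UNIV r. \<Sum>B'\<in>layer UNIV s. c A' * d B' * ?v A' B')"
    by (simp add: linear_sum[OF linear_vol] linear_scale[OF linear_vol])
  also have "\<dots> = (\<Sum>(A', B')\<in>?I. c A' * d B' * ?v A' B')" by (rule sum.cartesian_product)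
  also have "\<dots> = (\<Sum>(A', B')\<in>{(A, B)}. c A' * d B' * ?v A' B')"
  proof (rule sum.mono_neutral_right)
    show "\<forall>p\<in>?I - {(A, B)}. (case p of (A', B') \<Rightarrow> c A' * d B' * ?v A' B') = 0"
    proof
      fix p assume "p \<in> ?I - {(A, B)}"
      then show "(case p of (A', B') \<Rightarrow> c A' * d B' * ?v A' B') = 0"
        using other[of "fst p" "snd p"] by (simp only: case_prod_beta mem_Times_iff Diff_iff insert_iff prod.collapse) simp
    qed
  qed (use A B in simp_all)
  also have "\<dots> = c A * d B * ?v A B" by simp
  finally have "c A * d B * ?v A B = 0" using zero[OF u(1) w(1)] by (simp add: linear_0[OF linear_vol])
  then show False using cA(1) dB(1) vol_base_wedge3_nonzero[OF AB refl] by simp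
qed

theorem theorem2p4:
  fixes U W :: "(real ^ 'n) exterior set"
    and r s :: nat
  assumes "1 \<le> r" and "real r \<le> real CARD('n) / 2"
    and "1 \<le> s" and "real s \<le> real CARD('n) / 2"
    and "subspace U" and "U \<subseteq> ext_power r"
    and "subspace W" and "W \<subseteq> ext_power s"
    and "\<And>u w. u \<in> U \<Longrightarrow> w \<in> W \<Longrightarrow> u \<^bold>\<and> w = 0"
  shows "dim U * dim W \<le> ((CARD('n) - 1) choose (r - 1)) * ((CARD('n) - 1) choose (s - 1))"
proof -
  let ?F = "(`) index ` leading_sets r U" and ?G = "(`) index ` leading_sets s W"
  have layer: "(`) index ` leading_sets k S \<subseteq> layer {..<CARD('n)} k" for k and S :: "(real ^ 'n) exterior set"
    using index_less[where 'n = 'n] by (auto simp: leading_sets_def layer_def card_image inj_on_subset[OF inj_index])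
  have card: "card ((`) index ` leading_sets k S) = card (leading_sets k S)" for k and S :: "(real ^ 'n) exterior set"
    by (intro card_image inj_onI) (simp add: inj_image_eq_iff[OF inj_index])
  have "cross_intersecting (leading_sets r U) (leading_sets s W)"
    by (rule leading_sets_cross_intersecting[OF assms(6,8,9)])
  then have "cross_intersecting ?F ?G"
    unfolding cross_intersecting_def by (simp flip: image_Int[OF inj_index])
  then have "cross_sizes CARD('n) r s (card (leading_sets r U)) (card (leading_sets s W))"
    by (intro cross_sizesI[OF finite_lessThan _ layer layer _ card card]) simp_all
  then have "card (leading_sets r U) * card (leading_sets s W) \<le> star_count CARD('n) r * star_count CARD('n) s"
    by (rule cross_sizes_product) (use assms(2,4) in linarith)+
  moreover have "dim U * dim W \<le> card (leading_sets r U) * card (leading_sets s W)"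
    using assms by (intro mult_le_mono dim_le_card_leading_sets)
  ultimately show ?thesis using assms(1,3) by (simp add: star_count_def)
qed

end
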